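(* Let $f:\{1,2,\dots\}\to(0,\infty)$ be an attachment function such that: (i) $f_*:=\inf_{i\ge1}f(i)>0$; (ii) there is $C<\infty$ with $f(k)\le Ck$ for all $k\ge1$; (iii) with $\hat\rho(\lambda):=\sum_{k=1}^\infty\prod_{i=1}^k\frac{f(i)}{\lambda+f(i)}$ for $\lambda>0$ and $\underline\lambda:=\inf\{\lambda>0:\hat\rho(\lambda)<\infty\}$, one has $\underline\lambda<\infty$ and $\lim_{\lambda\downarrow\underline\lambda}\hat\rho(\lambda)>1$; (iv) $\limsup_{i\to\infty}f(i)/i<\lambda^*$, where $\lambda^*\in(0,\infty)$ is the unique solution of $\hat\rho(\lambda^* )=1$. Let $K_\Psi(\varepsilon)$ denote the minimal budget of the Jordan-centrality root finding algorithm for the random trees $\{\mathcal T_f(n):n\ge2\}$. (a) If there exist $\underline C_f>0$ and $\beta\ge0$ such that $f(i)\ge\underline C_f\, i+\beta$ for all $i\ge1$, then there exists a positive constant $C_1'$ such that for every $0<\varepsilon<1$, $$K_\Psi(\varepsilon)\ge\frac{C_1'}{\varepsilon^{(2\underline C_f+\beta)/f(1)}}.$$ (b) For general $f$ (satisfying (i)–(iv)), there exists a positive constant $C_1'$ such that for every $0<\varepsilon<1$, $$K_\Psi(\varepsilon)\ge\frac{C_1'}{\varepsilon^{f_*/f(1)}}.$$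
   Context: Random trees $\mathcal T_f(n)$: $\mathcal T_f(2)$ consists of two vertices $v_1,v_2$ joined by an edge; $v_1$ is the root. For $n>2$, given $\mathcal T_f(n-1)$ with vertices $v_1,\dots,v_{n-1}$, a new vertex $v_n$ is attached by a single edge to a vertex $v\in\mathcal T_f(n-1)$ chosen with probability proportional to $f(\deg(v))$, where $\deg(v)$ is the degree of $v$ in $\mathcal T_f(n-1)$. Let $\mathcal T^\circ$ denote the isomorphism class of a tree $\mathcal T$ as an unlabelled, unrooted tree. For a finite tree $\mathbf t$ and vertices $u,v$, let $(\mathbf t,v)_{u\downarrow}$ be the subtree consisting of $u$ and its descendants when $\mathbf t$ is rooted at $v$. The Jordan centrality is $\Psi_{\mathbf t}(v):=\max_{u\in\mathbf t\setminus\{v\}}|(\mathbf t,v)_{u\downarrow}|$ (smaller values are more central). For an integer $K\ge1$, $H_{K,\Psi}(\mathbf t)$ is the set of $K$ vertices of $\mathbf t$ with the smallest $\Psi_{\mathbf t}$-values, ties broken arbitrarily. For $0<\varepsilon<1$, $H_{K,\Psi}$ is a budget-$K$ root finding algorithm with error tolerance $\varepsilon$ if $\liminf_{n\to\infty}\mathbb P(v_1\in H_{K,\Psi}(\mathcal T_f(n)^\circ))\ge1-\varepsilon$. $K_\Psi(\varepsilon)$ is the smallest $K$ for which this holds, and $K_\Psi(\varepsilon)=\infty$ if there is no such finite $K$. *)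

theory Defs
  imports "HOL-Probability.Probability"
begin

section \<open>Finite trees and Jordan centrality\<close>

type_synonym 'a graph = "'a set \<times> 'a set set"

abbreviation verts :: "'a graph \<Rightarrow> 'a set" where "verts t \<equiv> fst t"
abbreviation edges :: "'a graph \<Rightarrow> 'a set set" where "edges t \<equiv> snd t"

definition vertex_degree :: "'a graph \<Rightarrow> 'a \<Rightarrow> nat" where
  "vertex_degree t v = card {e \<in> edges t. v \<in> e}"

definition is_path :: "'a graph \<Rightarrow> 'a \<Rightarrow> 'a list \<Rightarrow> 'a \<Rightarrow> bool" where
  "is_path t u xs v \<longleftrightarrow> xs \<noteq> [] \<and> hd xs = u \<and> last xs = v \<and> distinct xs \<and> set xs \<subseteq> verts t \<and>
     successively (\<lambda>x y. {x, y} \<in> edges t) xs"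

definition finite_tree :: "'a graph \<Rightarrow> bool" where
  "finite_tree t \<longleftrightarrow> finite (verts t) \<and> verts t \<noteq> {} \<and>
     (\<forall>e \<in> edges t. e \<subseteq> verts t \<and> card e = 2) \<and>
     (\<forall>u \<in> verts t. \<forall>v \<in> verts t. \<exists>!xs. is_path t u xs v)"

definition descendants :: "'a graph \<Rightarrow> 'a \<Rightarrow> 'a \<Rightarrow> 'a set" where
  \<comment> \<open>the vertex set of the subtree at \<open>u\<close> when \<open>t\<close> is rooted at \<open>v\<close>\<close>
  "descendants t v u = {w. \<exists>xs. is_path t v xs w \<and> u \<in> set xs}"

definition jordan_centrality :: "'a graph \<Rightarrow> 'a \<Rightarrow> nat" where
  "jordan_centrality t v = Max ((\<lambda>u. card (descendants t v u)) ` (verts t - {v}))"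

text \<open>A choice of the \<open>K\<close> most central vertices for every budget \<open>K\<close> and every tree; the freedom
  in the choice is exactly the tie-breaking. If \<open>t\<close> has fewer than \<open>K\<close> vertices, all are taken.\<close>

definition jordan_algorithm :: "(nat \<Rightarrow> 'a graph \<Rightarrow> 'a set) \<Rightarrow> bool" where
  "jordan_algorithm H \<longleftrightarrow> (\<forall>K \<ge> 1. \<forall>t. finite_tree t \<and> card (verts t) \<ge> 2 \<longrightarrow>
     H K t \<subseteq> verts t \<and> card (H K t) = min K (card (verts t)) \<and>
     (\<forall>u \<in> H K t. \<forall>v \<in> verts t - H K t. jordan_centrality t u \<le> jordan_centrality t v))"


section \<open>Unlabelled trees\<close>

text \<open>Extensionality keeps the set of isomorphisms between two finite graphs finite.\<close>

definition graph_isos :: "'a graph \<Rightarrow> 'a graph \<Rightarrow> ('a \<Rightarrow> 'a) set" where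
  "graph_isos t t' = {\<phi> \<in> extensional (verts t).
     bij_betw \<phi> (verts t) (verts t') \<and> edges t' = (\<lambda>e. \<phi> ` e) ` edges t}"

definition iso_class :: "'a graph \<Rightarrow> 'a graph set" where
  "iso_class t = {t'. graph_isos t t' \<noteq> {}}"

definition representative :: "'a graph set \<Rightarrow> 'a graph" where
  "representative c = (SOME t. t \<in> c)"


section \<open>The random trees\<close>

text \<open>The vertex \<open>v\<^sub>i\<close> is the natural number \<open>i\<close>.\<close>

definition attach_vertex :: "(nat \<Rightarrow> real) \<Rightarrow> nat graph \<Rightarrow> nat pmf" where
  "attach_vertex f t = embed_pmf (\<lambda>v. if v \<in> verts t
     then f (vertex_degree t v) / (\<Sum>w \<in> verts t. f (vertex_degree t w)) else 0)"

lemma pmf_attach_vertex: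
  assumes "finite (verts t)" "verts t \<noteq> {}" "\<And>w. w \<in> verts t \<Longrightarrow> f (vertex_degree t w) > 0"
  shows "pmf (attach_vertex f t) v = (if v \<in> verts t
     then f (vertex_degree t v) / (\<Sum>w \<in> verts t. f (vertex_degree t w)) else 0)"
proof -
  let ?S = "\<Sum>w \<in> verts t. f (vertex_degree t w)"
  let ?g = "\<lambda>v. if v \<in> verts t then f (vertex_degree t v) / ?S else 0"
  have S: "?S > 0" using assms by (intro sum_pos) auto
  have nn: "?g v \<ge> 0" for v using S assms(3)[of v] by auto
  have "(\<integral>\<^sup>+v. ennreal (?g v) \<partial>count_space UNIV)
      = (\<integral>\<^sup>+v. ennreal (?g v) \<partial>count_space (verts t))"
    by (subst nn_integral_count_space_indicator) (auto intro!: nn_integral_cong split: split_indicator)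
  also have "\<dots> = (\<Sum>v \<in> verts t. ennreal (?g v))"
    using assms(1) by (rule nn_integral_count_space_finite)
  also have "\<dots> = ennreal (\<Sum>v \<in> verts t. ?g v)"
    by (intro sum_ennreal nn)
  also have "(\<Sum>v \<in> verts t. ?g v) = 1"
    using S by (simp add: sum_divide_distrib[symmetric])
  finally show ?thesis
    unfolding attach_vertex_def by (subst pmf_embed_pmf) (use nn in \<open>simp_all only: ennreal_1\<close>)
qed

text \<open>The values at \<open>0\<close> and \<open>1\<close> are junk.\<close>

fun random_tree :: "(nat \<Rightarrow> real) \<Rightarrow> nat \<Rightarrow> nat graph pmf" where
  "random_tree f (Suc (Suc (Suc n))) =
     bind_pmf (random_tree f (Suc (Suc n))) (\<lambda>t.
     map_pmf (\<lambda>v. (insert (n + 3) (verts t), insert {v, n + 3} (edges t))) (attach_vertex f t))"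
| "random_tree f _ = return_pmf ({1, 2}, {{1, 2}})"


section \<open>Root finding\<close>

text \<open>The algorithm only sees the isomorphism class of the tree. It is run on a fixed
  representative of the class, with which the actual tree is identified by a uniformly random
  isomorphism; so a choice between vertices that are related by an automorphism carries no
  information on which of them is the root.\<close>

definition root_found :: "(nat \<Rightarrow> real) \<Rightarrow> (nat graph \<Rightarrow> nat set) \<Rightarrow> nat \<Rightarrow> bool pmf" where
  "root_found f H n =
     bind_pmf (random_tree f n) (\<lambda>t.
     let r = representative (iso_class t) in
     map_pmf (\<lambda>\<phi>. \<phi> 1 \<in> H r) (pmf_of_set (graph_isos t r)))"

definition root_finding :: "(nat \<Rightarrow> real) \<Rightarrow> (nat graph \<Rightarrow> nat set) \<Rightarrow> real \<Rightarrow> bool" where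
  "root_finding f H \<epsilon> \<longleftrightarrow>
     liminf (\<lambda>n. ereal (measure_pmf.prob (root_found f H n) {True})) \<ge> ereal (1 - \<epsilon>)"

text \<open>The infimum of the empty set is \<open>\<infinity>\<close>.\<close>

definition min_budget :: "(nat \<Rightarrow> real) \<Rightarrow> (nat \<Rightarrow> nat graph \<Rightarrow> nat set) \<Rightarrow> real \<Rightarrow> enat" where
  "min_budget f H \<epsilon> = Inf (enat ` {K. K \<ge> 1 \<and> root_finding f (H K) \<epsilon>})"


section \<open>The Malthusian parameter\<close>

definition rho_hat :: "(nat \<Rightarrow> real) \<Rightarrow> real \<Rightarrow> ennreal" where
  "rho_hat f x = (\<Sum>k. ennreal (\<Prod>i = 1..Suc k. f i / (x + f i)))"

definition lambda_low :: "(nat \<Rightarrow> real) \<Rightarrow> ereal" where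
  "lambda_low f = Inf (ereal ` {x. x > 0 \<and> rho_hat f x < \<infinity>})"

definition lambda_star :: "(nat \<Rightarrow> real) \<Rightarrow> real" where
  "lambda_star f = (THE x. x > 0 \<and> rho_hat f x = 1)"

end

theory Submission
  imports Defs
begin

text \<open>Let \<open>a\<^sub>m\<close> be the probability that the root \<open>v\<^sub>1\<close> is still a leaf when the tree has \<open>m\<close> vertices. On
this event the root is a bad guess: with probability bounded below, a positive proportion of the
\<open>m\<close> vertices that arrive next end up more central than it. So a budget that is a small multiple
of \<open>m\<close> misses the root with probability at least a constant times \<open>a\<^sub>m\<close>, that is, an error \<open>\<epsilon>\<close> of order \<open>a\<^sub>m\<close> costs a budget of
order \<open>m\<close>. It remains to see how fast \<open>a\<^sub>m\<close> decays. A leaf is hit at time \<open>k\<close> with probability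
\<open>f 1\<close> divided by the total weight, and if the total weight is at least \<open>g k - h\<close>, then \<open>a\<^sub>m\<close> decays
no faster than \<open>m\<close> to the power \<open>- f 1 / g\<close> (\<open>survival_decay\<close>). As the degrees in a tree with \<open>k\<close>
vertices sum to \<open>2 (k - 1)\<close>, the bound \<open>f i \<ge> C\<^sub>f i + \<beta>\<close> gives \<open>g = 2 C\<^sub>f + \<beta>\<close>, and \<open>f \<ge> f\<^sub>*\<close> gives
\<open>g = f\<^sub>*\<close>.\<close>

text \<open>To compare the root with \<open>v\<^sub>j\<close>, start at time \<open>j\<close>. If the root is still a leaf then, \<open>v\<^sub>1\<close> and \<open>v\<^sub>j\<close>
are two leaves of the same tree. Let \<open>A\<close> and \<open>B\<close> be the branches that later grow out of them.
The vertex with the larger branch is the more central one (\<open>larger_branch_more_central\<close>), because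
all vertices outside a branch lie in a single subtree as seen from the vertex that carries the
branch. Exchanging the two leaves does not change the law of the growth
(\<open>marked_symmetric\<close>), so each of \<open>|A| < |B|\<close> and \<open>|B| < |A|\<close> has half of the probability of
\<open>|A| \<noteq> |B|\<close>.\<close>

text \<open>Ties must be excluded with positive probability, because an algorithm may break them in favour of
the root. Consider the expectation of \<open>1 / (|A| + |B|)\<close> on the event \<open>|A| = |B|\<close>. The
probability that the next vertex joins \<open>A\<close> or \<open>B\<close> lies between two constant multiples of
\<open>(|A| + |B|) / n\<close>, by \<open>f\<^sub>* \<le> f i \<le> C i\<close>. So in step \<open>n\<close> the expectation loses at least \<open>c / n\<close> times
the probability of a tie, and gains at most \<open>c' / n\<close> times the probability of no tie. As the
harmonic series diverges and the expectation stays nonnegative, the probability of no tie is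
bounded below by a constant fraction of \<open>a\<^sub>j\<close> infinitely often (\<open>untied_infinitely_often\<close>). This is
enough, because the error of an algorithm is defined by a lower limit. Summing over \<open>m < j \<le> 2 m\<close> and
comparing with the trivial bound \<open>m\<close> for the number of these vertices turns the estimates of single
probabilities into many simultaneous competitors (\<open>many_more_central\<close>).\<close>

section \<open>Branches and Jordan centrality\<close>

text \<open>A branch is a side of an edge \<open>{x, y}\<close> that is the only edge between the two sides; \<open>x\<close> is its end
in the branch.\<close>

definition branch :: "'a graph \<Rightarrow> 'a set \<Rightarrow> 'a \<Rightarrow> bool" where
  "branch t A x \<longleftrightarrow> A \<subseteq> verts t \<and> x \<in> A \<and>
     (\<exists>y \<in> verts t - A. {x, y} \<in> edges t \<and> (\<forall>e \<in> edges t. e \<inter> A \<noteq> {} \<longrightarrow> e \<subseteq> A \<or> e = {x, y}))"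

text \<open>A walk that changes sides uses the edge \<open>{x, y}\<close> and so passes through \<open>x\<close>.\<close>

lemma walk_stays_on_side:
  assumes br: "branch t A x"
    and walk: "successively (\<lambda>u v. {u, v} \<in> edges t) xs" and "x \<notin> set xs"
  shows "set xs \<subseteq> A \<or> set xs \<inter> A = {}"
  using walk \<open>x \<notin> set xs\<close>
proof (induction xs)
  case (Cons u us)
  show ?case
  proof (cases us)
    case (Cons v vs)
    have uv: "{u, v} \<in> edges t" and us: "successively (\<lambda>u v. {u, v} \<in> edges t) us"
      using Cons.prems(1) Cons by simp_all
    have "{u, v} \<noteq> {x, y}" for y using Cons.prems(2) Cons by (auto simp: doubleton_eq_iff)
    moreover obtain y where y: "\<forall>e \<in> edges t. e \<inter> A \<noteq> {} \<longrightarrow> e \<subseteq> A \<or> e = {x, y}"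
      using br unfolding branch_def by blast
    ultimately have "{u, v} \<inter> A \<noteq> {} \<longrightarrow> {u, v} \<subseteq> A" using bspec[OF y uv] by metis
    moreover have "set us \<subseteq> A \<or> set us \<inter> A = {}" using Cons.IH us Cons.prems(2) by simp
    ultimately show ?thesis using Cons by auto
  qed auto
qed simp

text \<open>A path from \<open>x\<close> never returns to \<open>x\<close>, so after its start it stays on one side.\<close>

lemma path_beyond_start:
  assumes br: "branch t A x" and p: "is_path t x xs w" and u: "u \<in> set xs" "u \<noteq> x"
  shows "u \<in> A \<longleftrightarrow> w \<in> A" "w \<noteq> x"
proof -
  obtain us where xs: "xs = x # us" using p by (cases xs) (auto simp: is_path_def)
  hence uus: "u \<in> set us" using u by auto
  have "x \<notin> set us" using p xs by (simp add: is_path_def)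
  moreover have "successively (\<lambda>u v. {u, v} \<in> edges t) us"
    using p xs by (auto simp: is_path_def successively_Cons)
  ultimately have "set us \<subseteq> A \<or> set us \<inter> A = {}" using walk_stays_on_side[OF br] by blast
  moreover have "w \<in> set us" using p xs uus by (auto simp: is_path_def)
  ultimately show "u \<in> A \<longleftrightarrow> w \<in> A" "w \<noteq> x" using uus \<open>x \<notin> set us\<close> by auto
qed

lemma path_in_verts: "is_path t u xs w \<Longrightarrow> u \<in> verts t \<and> w \<in> verts t"
  by (auto simp: is_path_def)

lemma descendants_subset: "descendants t v u \<subseteq> verts t"
  by (auto simp: descendants_def dest: path_in_verts)

text \<open>All vertices outside the branch descend from the neighbour \<open>y\<close> when the tree is rooted at \<open>x\<close>.\<close>

lemma jordan_centrality_branch_ge: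
  assumes tree: "finite_tree t" and br: "branch t A x"
  shows "card (verts t) - card A \<le> jordan_centrality t x"
proof -
  obtain y where y: "y \<in> verts t - A"
    "\<And>e. e \<in> edges t \<Longrightarrow> e \<inter> A \<noteq> {} \<Longrightarrow> e \<subseteq> A \<or> e = {x, y}"
    and x: "x \<in> A" "A \<subseteq> verts t"
    using br unfolding branch_def by blast
  have fin: "finite (verts t)" using tree by (simp add: finite_tree_def)
  have "verts t - A \<subseteq> descendants t x y"
  proof
    fix w assume w: "w \<in> verts t - A"
    then obtain xs where p: "is_path t x xs w"
      using tree x unfolding finite_tree_def by blast
    have "w \<noteq> x" using w x by auto
    then obtain v vs where xs: "xs = x # v # vs"
      using p by (cases xs rule: remdups_adj.cases) (auto simp: is_path_def)
    have "v \<noteq> x" "{x, v} \<in> edges t" using p xs by (auto simp: is_path_def)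
    moreover have "v \<notin> A" using path_beyond_start(1)[OF br p, of v] xs w \<open>v \<noteq> x\<close> by auto
    ultimately have "v = y" using y(2)[of "{x, v}"] x by (auto simp: doubleton_eq_iff)
    thus "w \<in> descendants t x y" using p xs unfolding descendants_def by auto
  qed
  hence "card (verts t - A) \<le> card (descendants t x y)"
    by (rule card_mono[OF finite_subset[OF descendants_subset fin]])
  moreover have "card (verts t - A) = card (verts t) - card A"
    using x fin by (meson card_Diff_subset finite_subset)
  moreover have "card (descendants t x y) \<le> jordan_centrality t x"
    unfolding jordan_centrality_def using y(1) x fin by (intro Max_ge) auto
  ultimately show ?thesis by simp
qed

text \<open>Seen from \<open>x\<close>, a subtree lies either outside the branch, or inside it and misses \<open>x\<close>.\<close>

lemma jordan_centrality_branch_le: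
  assumes tree: "finite_tree t" and br: "branch t A x"
  shows "jordan_centrality t x \<le> max (card (verts t) - card A) (card A - 1)"
proof -
  have fin: "finite (verts t)" using tree by (simp add: finite_tree_def)
  have x: "x \<in> A" "A \<subseteq> verts t" and ne: "verts t - A \<noteq> {}"
    using br unfolding branch_def by blast+
  have finA: "finite A" using x fin finite_subset by blast
  have "card (descendants t x u) \<le> max (card (verts t) - card A) (card A - 1)" if "u \<noteq> x" for u
  proof (cases "u \<in> A")
    case True
    hence "descendants t x u \<subseteq> A - {x}"
      using path_beyond_start[OF br _ _ that] unfolding descendants_def by blast
    from card_mono[OF _ this] finA x show ?thesis by simp
  next
    case False
    hence "descendants t x u \<inter> A = {}"
      using path_beyond_start(1)[OF br _ _ that] unfolding descendants_def by blast
    hence "descendants t x u \<subseteq> verts t - A" using descendants_subset[of t x u] by blast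
    from card_mono[OF _ this] fin show ?thesis by (simp add: card_Diff_subset[OF finA x(2)])
  qed
  thus ?thesis unfolding jordan_centrality_def
    using fin ne x by (subst Max_le_iff) auto
qed

text \<open>Both terms of the upper bound for \<open>y\<close> are below the lower bound for \<open>x\<close>: the first since \<open>A\<close> is
smaller than \<open>B\<close>, the second since \<open>A\<close> and \<open>B\<close> are disjoint. The second one matters when \<open>B\<close>
contains more than half of the tree.\<close>

lemma larger_branch_more_central:
  assumes tree: "finite_tree t" and A: "branch t A x" and B: "branch t B y"
    and disj: "A \<inter> B = {}" and less: "card A < card B"
  shows "jordan_centrality t y < jordan_centrality t x"
proof -
  have fin: "finite (verts t)" using tree by (simp add: finite_tree_def)
  have sub: "A \<subseteq> verts t" "B \<subseteq> verts t" using A B by (auto simp: branch_def)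
  have "card A + card B = card (A \<union> B)"
    using card_Un_disjoint[OF finite_subset[OF sub(1) fin] finite_subset[OF sub(2) fin] disj] by simp
  also have "\<dots> \<le> card (verts t)" using sub fin by (intro card_mono) auto
  finally show ?thesis
    using jordan_centrality_branch_ge[OF tree A] jordan_centrality_branch_le[OF tree B] less
    by linarith
qed

section \<open>What an algorithm sees of the tree\<close>

lemma graph_isos_sym:
  assumes iso: "\<phi> \<in> graph_isos t r" and sub: "\<And>e. e \<in> edges t \<Longrightarrow> e \<subseteq> verts t"
  shows "\<exists>\<psi> \<in> graph_isos r t. \<forall>v \<in> verts t. \<psi> (\<phi> v) = v"
proof -
  have bij: "bij_betw \<phi> (verts t) (verts r)" and ed: "edges r = (\<lambda>e. \<phi> ` e) ` edges t"
    using iso by (auto simp: graph_isos_def)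
  define \<psi> where "\<psi> = restrict (inv_into (verts t) \<phi>) (verts r)"
  have inv: "\<psi> (\<phi> v) = v" if "v \<in> verts t" for v
    using that bij by (auto simp: \<psi>_def bij_betw_def)
  have "\<psi> ` (\<phi> ` e) = e" if "e \<in> edges t" for e
    using sub[OF that] inv by (force simp: image_image)
  hence "edges t = (\<lambda>e. \<psi> ` e) ` edges r" unfolding ed image_image by simp
  moreover have "bij_betw \<psi> (verts r) (verts t)"
    using bij_betw_inv_into[OF bij] by (subst bij_betw_cong[where g = "inv_into (verts t) \<phi>"]) (auto simp: \<psi>_def)
  ultimately have "\<psi> \<in> graph_isos r t" by (auto simp: graph_isos_def \<psi>_def)
  thus ?thesis using inv by blast
qed

lemma is_path_iso:
  assumes iso: "\<phi> \<in> graph_isos t r" and p: "is_path t u xs w"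
  shows "is_path r (\<phi> u) (map \<phi> xs) (\<phi> w)"
proof -
  have bij: "bij_betw \<phi> (verts t) (verts r)" and ed: "edges r = (\<lambda>e. \<phi> ` e) ` edges t"
    using iso by (auto simp: graph_isos_def)
  have "{\<phi> a, \<phi> b} \<in> edges r" if "{a, b} \<in> edges t" for a b
  proof -
    have "{\<phi> a, \<phi> b} = \<phi> ` {a, b}" by simp
    thus ?thesis unfolding ed using that by blast
  qed
  hence "successively (\<lambda>x y. {x, y} \<in> edges r) (map \<phi> xs)"
    using p unfolding is_path_def successively_map by (auto elim: successively_mono)
  moreover have "distinct (map \<phi> xs)" "set (map \<phi> xs) \<subseteq> verts r"
    using p bij inj_on_subset[of \<phi> "verts t" "set xs"] by (auto simp: is_path_def distinct_map bij_betw_def)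
  ultimately show ?thesis using p by (auto simp: is_path_def hd_map last_map)
qed

lemma is_path_iso_inverse:
  assumes iso: "\<phi> \<in> graph_isos t r" and sub: "\<And>e. e \<in> edges t \<Longrightarrow> e \<subseteq> verts t"
    and u: "u \<in> verts t" and w: "w \<in> verts t" and p: "is_path r (\<phi> u) ys (\<phi> w)"
  shows "\<exists>xs. ys = map \<phi> xs \<and> is_path t u xs w"
proof -
  obtain \<psi> where \<psi>: "\<psi> \<in> graph_isos r t" "\<And>v. v \<in> verts t \<Longrightarrow> \<psi> (\<phi> v) = v"
    using graph_isos_sym[OF iso sub] by blast
  have "verts r = \<phi> ` verts t" using iso by (auto simp: graph_isos_def bij_betw_def)
  hence "\<phi> (\<psi> v) = v" if "v \<in> set ys" for v
    using that p \<psi>(2) by (auto simp: is_path_def)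
  hence "ys = map \<phi> (map \<psi> ys)" by (simp add: map_idI)
  moreover have "is_path t u (map \<psi> ys) w"
    using is_path_iso[OF \<psi>(1) p] \<psi>(2) u w by simp
  ultimately show ?thesis by blast
qed

lemma finite_tree_iso:
  assumes iso: "\<phi> \<in> graph_isos t r" and tree: "finite_tree t"
  shows "finite_tree r"
proof -
  have bij: "bij_betw \<phi> (verts t) (verts r)" and ed: "edges r = (\<lambda>e. \<phi> ` e) ` edges t"
    using iso by (auto simp: graph_isos_def)
  have sub: "\<And>e. e \<in> edges t \<Longrightarrow> e \<subseteq> verts t" and c2: "\<And>e. e \<in> edges t \<Longrightarrow> card e = 2"
    using tree by (auto simp: finite_tree_def)
  have inj: "inj_on \<phi> (verts t)" and V: "verts r = \<phi> ` verts t" using bij by (auto simp: bij_betw_def)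
  have "\<exists>!ys. is_path r (\<phi> u) ys (\<phi> w)" if uw: "u \<in> verts t" "w \<in> verts t" for u w
  proof -
    have "\<exists>!xs. is_path t u xs w" using tree uw by (simp add: finite_tree_def)
    then obtain xs where xs: "is_path t u xs w" "\<And>xs'. is_path t u xs' w \<Longrightarrow> xs' = xs"
      by metis
    show ?thesis
    proof (rule ex1I)
      show "is_path r (\<phi> u) (map \<phi> xs) (\<phi> w)" using is_path_iso[OF iso xs(1)] .
      show "ys = map \<phi> xs" if "is_path r (\<phi> u) ys (\<phi> w)" for ys
        using is_path_iso_inverse[OF iso sub uw that] xs(2) by blast
    qed
  qed
  hence "\<forall>u' \<in> verts r. \<forall>w' \<in> verts r. \<exists>!ys. is_path r u' ys w'" unfolding V ball_simps by blast
  moreover have "card (\<phi> ` e) = 2" "\<phi> ` e \<subseteq> verts r" if "e \<in> edges t" for e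
    using image_mono[OF sub[OF that]] c2[OF that] V card_image[OF inj_on_subset[OF inj sub[OF that]]]
    by simp_all
  hence "\<forall>e \<in> edges r. e \<subseteq> verts r \<and> card e = 2" unfolding ed by blast
  moreover have "finite (verts r)" "verts r \<noteq> {}" using tree V by (auto simp: finite_tree_def)
  ultimately show ?thesis unfolding finite_tree_def by blast
qed

lemma jordan_centrality_iso:
  assumes iso: "\<phi> \<in> graph_isos t r" and tree: "finite_tree t" and v: "v \<in> verts t"
  shows "jordan_centrality r (\<phi> v) = jordan_centrality t v"
proof -
  have bij: "bij_betw \<phi> (verts t) (verts r)" using iso by (auto simp: graph_isos_def)
  have sub: "\<And>e. e \<in> edges t \<Longrightarrow> e \<subseteq> verts t" using tree by (auto simp: finite_tree_def)
  have inj: "inj_on \<phi> (verts t)" and V: "verts r = \<phi> ` verts t" using bij by (auto simp: bij_betw_def)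
  have desc: "descendants r (\<phi> v) (\<phi> u) = \<phi> ` descendants t v u" if u: "u \<in> verts t" for u
  proof (intro subset_antisym subsetI)
    fix w' assume "w' \<in> descendants r (\<phi> v) (\<phi> u)"
    then obtain ys where ys: "is_path r (\<phi> v) ys w'" "\<phi> u \<in> set ys" by (auto simp: descendants_def)
    then obtain w where w: "w' = \<phi> w" "w \<in> verts t" using path_in_verts[OF ys(1)] V by auto
    then obtain xs where xs: "ys = map \<phi> xs" "is_path t v xs w"
      using is_path_iso_inverse[OF iso sub v] ys(1) by blast
    then obtain u' where "u' \<in> set xs" "\<phi> u' = \<phi> u" using ys(2) by auto
    moreover have "u' \<in> verts t" using xs(2) \<open>u' \<in> set xs\<close> by (auto simp: is_path_def)
    ultimately have "u \<in> set xs" using inj u by (metis inj_onD)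
    thus "w' \<in> \<phi> ` descendants t v u" using xs w by (auto simp: descendants_def)
  next
    fix w' assume "w' \<in> \<phi> ` descendants t v u"
    then obtain w xs where "w' = \<phi> w" "is_path t v xs w" "u \<in> set xs" by (auto simp: descendants_def)
    thus "w' \<in> descendants r (\<phi> v) (\<phi> u)"
      using is_path_iso[OF iso] by (fastforce simp: descendants_def)
  qed
  have "verts r - {\<phi> v} = \<phi> ` (verts t - {v})" using inj v V by (auto simp: inj_on_def)
  moreover have "card (descendants r (\<phi> v) (\<phi> u)) = card (descendants t v u)" if "u \<in> verts t" for u
    using desc[OF that] card_image[OF inj_on_subset[OF inj descendants_subset]] by simp
  ultimately have "(\<lambda>u. card (descendants r (\<phi> v) u)) ` (verts r - {\<phi> v})
      = (\<lambda>u. card (descendants t v u)) ` (verts t - {v})"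
    by (auto simp: image_image intro!: image_cong)
  thus ?thesis by (simp add: jordan_centrality_def)
qed

lemma finite_graph_isos:
  assumes "finite (verts t)" "finite (verts r)"
  shows "finite (graph_isos t r)"
proof (rule finite_subset)
  show "graph_isos t r \<subseteq> PiE (verts t) (\<lambda>_. verts r)"
    by (auto simp: graph_isos_def bij_betw_def PiE_def)
  show "finite (PiE (verts t) (\<lambda>_. verts r))" using assms by (intro finite_PiE) auto
qed

lemma representative_iso:
  assumes sub: "\<And>e. e \<in> edges t \<Longrightarrow> e \<subseteq> verts t"
  shows "graph_isos t (representative (iso_class t)) \<noteq> {}"
proof -
  have "(\<lambda>e. restrict id (verts t) ` e) ` edges t = (\<lambda>e. e) ` edges t"
    using sub by (intro image_cong refl) (force simp: image_iff)
  hence "restrict id (verts t) \<in> graph_isos t t"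
    by (auto simp: graph_isos_def bij_betw_def inj_on_def)
  hence "t \<in> iso_class t" unfolding iso_class_def by blast
  hence "representative (iso_class t) \<in> iso_class t" unfolding representative_def by (rule someI)
  thus ?thesis by (simp add: iso_class_def)
qed

text \<open>If at least \<open>K\<close> vertices are strictly more central than \<open>v\<close>, an output of size \<open>K\<close> that contains
\<open>v\<close> would have to leave one of them out. This holds for every isomorphism, so neither the
tie-breaking nor the random identification can help.\<close>

lemma jordan_algorithm_misses:
  assumes alg: "jordan_algorithm H" and K: "K \<ge> 1"
    and tree: "finite_tree t" and two: "card (verts t) \<ge> 2"
    and iso: "\<phi> \<in> graph_isos t r" and v: "v \<in> verts t"
    and many: "J \<subseteq> verts t" "card J \<ge> K" "\<And>u. u \<in> J \<Longrightarrow> jordan_centrality t u < jordan_centrality t v"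
  shows "\<phi> v \<notin> H K r"
proof
  assume in_H: "\<phi> v \<in> H K r"
  have bij: "bij_betw \<phi> (verts t) (verts r)" using iso by (auto simp: graph_isos_def)
  have "card (verts r) \<ge> 2" using two bij_betw_same_card[OF bij] by simp
  hence H: "H K r \<subseteq> verts r" "card (H K r) = min K (card (verts r))"
    "\<And>a b. a \<in> H K r \<Longrightarrow> b \<in> verts r - H K r \<Longrightarrow> jordan_centrality r a \<le> jordan_centrality r b"
    using alg K finite_tree_iso[OF iso tree] unfolding jordan_algorithm_def by blast+
  have "\<phi> ` J \<subseteq> H K r"
  proof (rule ccontr)
    assume "\<not> \<phi> ` J \<subseteq> H K r"
    then obtain u where u: "u \<in> J" "\<phi> u \<notin> H K r" by blast
    hence "\<phi> u \<in> verts r" using many(1) bij by (auto simp: bij_betw_def)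
    hence "jordan_centrality r (\<phi> v) \<le> jordan_centrality r (\<phi> u)" using H(3) in_H u by blast
    thus False using many(1,3) u v jordan_centrality_iso[OF iso tree] by (metis in_mono leD)
  qed
  moreover have "v \<notin> J" using many(3) by blast
  hence "\<phi> v \<notin> \<phi> ` J" using bij v many(1) by (auto simp: bij_betw_def inj_on_def)
  ultimately have "insert (\<phi> v) (\<phi> ` J) \<subseteq> H K r" using in_H by blast
  moreover have fin: "finite (verts t)" "finite (verts r)"
    using tree finite_tree_iso[OF iso tree] by (auto simp: finite_tree_def)
  ultimately have "card (insert (\<phi> v) (\<phi> ` J)) \<le> card (H K r)"
    using H(1) finite_subset by (intro card_mono) auto
  moreover have "card (\<phi> ` J) = card J"
    using bij many(1) by (meson bij_betw_def card_image inj_on_subset)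
  moreover have "finite (\<phi> ` J)" using fin many(1) finite_subset by blast
  ultimately show False using \<open>\<phi> v \<notin> \<phi> ` J\<close> many(2) H(2) by simp
qed

section \<open>Growing a tree by a leaf\<close>

definition add_leaf :: "'a graph \<Rightarrow> 'a \<Rightarrow> 'a \<Rightarrow> 'a graph" where
  "add_leaf t v n = (insert n (verts t), insert {v, n} (edges t))"

lemma verts_add_leaf [simp]: "verts (add_leaf t v n) = insert n (verts t)"
  and edges_add_leaf [simp]: "edges (add_leaf t v n) = insert {v, n} (edges t)"
  by (simp_all add: add_leaf_def)

lemma finite_tree_edges:
  assumes "finite_tree t"
  shows "finite (verts t)" "finite (edges t)" "edges t \<subseteq> Pow (verts t)" "\<And>e. e \<in> edges t \<Longrightarrow> card e = 2"
proof -
  show fin: "finite (verts t)" and sub: "edges t \<subseteq> Pow (verts t)"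
    and "\<And>e. e \<in> edges t \<Longrightarrow> card e = 2" using assms by (auto simp: finite_tree_def)
  show "finite (edges t)" using fin finite_subset[OF sub] by blast
qed

lemma vertex_degree_add_leaf:
  assumes fin: "finite (edges t)" and sub: "edges t \<subseteq> Pow (verts t)"
    and v: "v \<in> verts t" and n: "n \<notin> verts t"
  shows "vertex_degree (add_leaf t v n) u =
    (if u = n then 1 else if u = v then Suc (vertex_degree t u) else vertex_degree t u)"
proof -
  have new: "{v, n} \<notin> edges t" using sub n by blast
  have "{e \<in> insert {v, n} (edges t). u \<in> e} =
      (if u = v \<or> u = n then insert {v, n} {e \<in> edges t. u \<in> e} else {e \<in> edges t. u \<in> e})"
    by auto
  moreover have "{e \<in> edges t. n \<in> e} = {}" using sub n by blast
  ultimately show ?thesis using fin new v n by (auto simp: vertex_degree_def)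
qed

lemma is_path_rev: "is_path t u xs w \<Longrightarrow> is_path t w (rev xs) u"
  by (auto simp: is_path_def hd_rev last_rev successively_rev insert_commute)

text \<open>The new leaf has \<open>v\<close> as its only neighbour, so a path through it would visit \<open>v\<close> twice.\<close>

lemma is_path_add_leaf_avoids:
  assumes sub: "edges t \<subseteq> Pow (verts t)" and n: "n \<notin> verts t"
    and p: "is_path (add_leaf t v n) u xs w" and ends: "u \<noteq> n" "w \<noteq> n"
  shows "n \<notin> set xs"
proof
  assume "n \<in> set xs"
  then obtain as bs where xs: "xs = as @ n # bs" by (auto simp: in_set_conv_decomp)
  have nb: "a = v" if "{a, n} \<in> insert {v, n} (edges t)" for a
    using that sub n by (auto simp: doubleton_eq_iff)
  have ne: "as \<noteq> []" "bs \<noteq> []" using p xs ends by (auto simp: is_path_def)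
  have "{last as, n} \<in> insert {v, n} (edges t)" "{hd bs, n} \<in> insert {v, n} (edges t)"
    using p ne unfolding xs is_path_def
    by (auto simp: successively_append_iff successively_Cons insert_commute)
  hence "last as = hd bs" using nb by metis
  thus False using p ne unfolding xs is_path_def
    by (metis IntI distinct_append empty_iff hd_in_set last_in_set list.set_intros(2))
qed

lemma is_path_add_leaf_iff:
  assumes "n \<notin> verts t" "n \<notin> set xs"
  shows "is_path (add_leaf t v n) u xs w \<longleftrightarrow> is_path t u xs w"
proof -
  have "successively (\<lambda>x y. {x, y} \<in> insert {v, n} (edges t)) xs \<longleftrightarrow> successively (\<lambda>x y. {x, y} \<in> edges t) xs"
    using assms(2) by (intro successively_cong) (auto simp: doubleton_eq_iff)
  thus ?thesis using assms(2) by (auto simp: is_path_def)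
qed

lemma is_path_from_new_leaf:
  assumes sub: "edges t \<subseteq> Pow (verts t)" and n: "n \<notin> verts t"
    and v: "v \<in> verts t" and w: "w \<noteq> n"
  shows "is_path (add_leaf t v n) n xs w \<longleftrightarrow> (\<exists>ys. xs = n # ys \<and> is_path t v ys w)"
proof
  assume p: "is_path (add_leaf t v n) n xs w"
  then obtain ys where xs: "xs = n # ys" by (cases xs) (auto simp: is_path_def)
  have ys: "ys \<noteq> []" "n \<notin> set ys" using p xs w by (auto simp: is_path_def)
  have "{n, hd ys} \<in> insert {v, n} (edges t)"
    using p xs ys by (auto simp: is_path_def successively_Cons)
  hence "hd ys = v" using sub n by (auto simp: doubleton_eq_iff)
  hence "is_path (add_leaf t v n) v ys w" using p xs ys by (auto simp: is_path_def successively_Cons)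
  thus "\<exists>ys. xs = n # ys \<and> is_path t v ys w" using xs is_path_add_leaf_iff[OF n ys(2)] by metis
next
  assume "\<exists>ys. xs = n # ys \<and> is_path t v ys w"
  then obtain ys where xs: "xs = n # ys" and p: "is_path t v ys w" by blast
  have "n \<notin> set ys" using p n by (auto simp: is_path_def)
  hence "is_path (add_leaf t v n) v ys w" using is_path_add_leaf_iff[OF n] p by metis
  thus "is_path (add_leaf t v n) n xs w"
    using xs \<open>n \<notin> set ys\<close> by (auto simp: is_path_def successively_Cons insert_commute)
qed

lemma finite_tree_add_leaf:
  assumes tree: "finite_tree t" and v: "v \<in> verts t" and n: "n \<notin> verts t"
  shows "finite_tree (add_leaf t v n)"
proof -
  note sub = finite_tree_edges(3)[OF tree]
  let ?t = "add_leaf t v n"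
  have ex1: "\<exists>!xs. is_path t u xs w" if "u \<in> verts t" "w \<in> verts t" for u w
    using tree that by (simp add: finite_tree_def)
  have from_n: "\<exists>!xs. is_path ?t n xs w" if w: "w \<in> verts t" for w
  proof -
    have "w \<noteq> n" using w n by blast
    note iff = is_path_from_new_leaf[OF sub n v this]
    show ?thesis using ex1[OF v w] unfolding iff by (metis list.inject)
  qed
  have "\<exists>!xs. is_path ?t u xs w" if uw: "u \<in> insert n (verts t)" "w \<in> insert n (verts t)" for u w
  proof -
    consider "u = n" "w = n" | "u = n" "w \<in> verts t" | "u \<in> verts t" "w = n"
      | "u \<in> verts t" "w \<in> verts t" using uw by blast
    thus ?thesis
    proof cases
      case 1
      have "is_path ?t n xs n \<longleftrightarrow> xs = [n]" for xs
        by (cases xs rule: rev_cases) (auto simp: is_path_def hd_append neq_Nil_conv)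
      thus ?thesis using 1 by auto
    next
      case 2 thus ?thesis using from_n by simp
    next
      case 3
      have "is_path ?t u xs n \<longleftrightarrow> is_path ?t n (rev xs) u" for xs
        using is_path_rev[of ?t u xs n] is_path_rev[of ?t n "rev xs" u] by auto
      thus ?thesis using 3 from_n[of u] by (metis rev_rev_ident)
    next
      case 4
      have "is_path ?t u xs w \<longleftrightarrow> is_path t u xs w" for xs
      proof (cases "n \<in> set xs")
        case True
        hence "\<not> is_path t u xs w" using n by (auto simp: is_path_def)
        moreover have "\<not> is_path ?t u xs w"
          using is_path_add_leaf_avoids[OF sub n, of v u xs w] True 4 n by blast
        ultimately show ?thesis by blast
      qed (simp add: is_path_add_leaf_iff n)
      thus ?thesis using ex1[OF 4] by simp
    qed
  qed
  moreover have "v \<noteq> n" using v n by blast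
  hence "card {v, n} = 2" by simp
  ultimately show ?thesis using tree v unfolding finite_tree_def by auto
qed

text \<open>A branch that grows from a single leaf \<open>x\<close> has \<open>card A - 1\<close> edges inside and one edge to
the outside, which gives its degree sum. The degree sum is what bounds the weight of the branch
from above.\<close>

definition pendant :: "'a graph \<Rightarrow> 'a set \<Rightarrow> 'a \<Rightarrow> bool" where
  "pendant t A x \<longleftrightarrow> branch t A x \<and> Suc (\<Sum>v\<in>A. vertex_degree t v) = 2 * card A"

definition extend :: "'a \<Rightarrow> 'a \<Rightarrow> 'a set \<Rightarrow> 'a set" where
  "extend v n A = (if v \<in> A then insert n A else A)"

lemma branch_extend:
  assumes br: "branch t A x" and sub: "edges t \<subseteq> Pow (verts t)"
    and v: "v \<in> verts t" and n: "n \<notin> verts t"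
  shows "branch (add_leaf t v n) (extend v n A) x"
proof -
  obtain y where y: "y \<in> verts t - A" "{x, y} \<in> edges t"
      "\<And>e. e \<in> edges t \<Longrightarrow> e \<inter> A \<noteq> {} \<Longrightarrow> e \<subseteq> A \<or> e = {x, y}"
    and A: "A \<subseteq> verts t" "x \<in> A"
    using br unfolding branch_def by blast
  have old: "e \<subseteq> extend v n A \<or> e = {x, y}" if "e \<in> edges t" "e \<inter> extend v n A \<noteq> {}" for e
  proof -
    have "n \<notin> e" using sub that(1) n by blast
    hence "e \<inter> A \<noteq> {}" using that(2) by (auto simp: extend_def split: if_splits)
    thus ?thesis using y(3)[OF that(1)] by (auto simp: extend_def)
  qed
  moreover have "{v, n} \<subseteq> extend v n A \<or> {v, n} \<inter> extend v n A = {}"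
    using A n by (auto simp: extend_def)
  moreover have "y \<notin> extend v n A" using y(1) n by (auto simp: extend_def)
  ultimately have "y \<in> verts (add_leaf t v n) - extend v n A \<and> {x, y} \<in> edges (add_leaf t v n) \<and>
      (\<forall>e \<in> edges (add_leaf t v n). e \<inter> extend v n A \<noteq> {} \<longrightarrow> e \<subseteq> extend v n A \<or> e = {x, y})"
    using y(1,2) by auto
  moreover have "extend v n A \<subseteq> verts (add_leaf t v n)" "x \<in> extend v n A"
    using A by (auto simp: extend_def)
  ultimately show ?thesis unfolding branch_def by blast
qed

lemma degree_sum_add_leaf:
  assumes fin: "finite (edges t)" and sub: "edges t \<subseteq> Pow (verts t)"
    and v: "v \<in> verts t" and n: "n \<notin> verts t" and A: "A \<subseteq> verts t" "finite A"
  shows "(\<Sum>u\<in>extend v n A. vertex_degree (add_leaf t v n) u) =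
    (\<Sum>u\<in>A. vertex_degree t u) + (if v \<in> A then 2 else 0)"
proof -
  have old: "vertex_degree (add_leaf t v n) u = vertex_degree t u + (if u = v then 1 else 0)" if "u \<in> A" for u
    using vertex_degree_add_leaf[OF fin sub v n] that A n by auto
  have "(\<Sum>u\<in>A. vertex_degree (add_leaf t v n) u) = (\<Sum>u\<in>A. vertex_degree t u) + (if v \<in> A then 1 else 0)"
    using A(2) by (simp add: old sum.distrib)
  moreover have "vertex_degree (add_leaf t v n) n = 1" using vertex_degree_add_leaf[OF fin sub v n] by simp
  moreover have "n \<notin> A" using A n by blast
  ultimately show ?thesis using A(2) by (simp add: extend_def)
qed

lemma pendant_extend:
  assumes pd: "pendant t A x" and tree: "finite_tree t" and v: "v \<in> verts t" and n: "n \<notin> verts t"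
  shows "pendant (add_leaf t v n) (extend v n A) x"
proof -
  note e = finite_tree_edges[OF tree]
  have A: "A \<subseteq> verts t" "finite A" using pd e(1) finite_subset by (auto simp: pendant_def branch_def)
  have "n \<notin> A" using A n by blast
  hence "card (extend v n A) = card A + (if v \<in> A then 1 else 0)" using A(2) by (simp add: extend_def)
  thus ?thesis
    using pd branch_extend[OF _ e(3) v n] degree_sum_add_leaf[OF e(2,3) v n A]
    by (auto simp: pendant_def)
qed

lemma pendant_leaf:
  assumes e: "{e \<in> edges t. x \<in> e} = {{x, y}}" and xy: "x \<in> verts t" "y \<in> verts t" "y \<noteq> x"
  shows "pendant t {x} x"
proof -
  have "{x, y} \<in> edges t" using e by blast
  moreover have "\<forall>e \<in> edges t. e \<inter> {x} \<noteq> {} \<longrightarrow> e \<subseteq> {x} \<or> e = {x, y}" using e by blast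
  ultimately have "branch t {x} x" unfolding branch_def using xy by blast
  thus ?thesis using e by (simp add: pendant_def vertex_degree_def)
qed

section \<open>The random trees\<close>

definition grown :: "nat \<Rightarrow> nat graph \<Rightarrow> bool" where
  "grown n t \<longleftrightarrow> finite_tree t \<and> verts t = {1..n} \<and> (\<forall>v \<in> verts t. vertex_degree t v \<ge> 1) \<and>
     (\<Sum>v \<in> verts t. vertex_degree t v) = 2 * (n - 1) \<and> {1, 2} \<in> edges t"

lemma grown_finite: "grown n t \<Longrightarrow> finite (verts t)"
  by (simp add: grown_def finite_tree_def)

lemma grown_2: "grown 2 ({1, 2}, {{1, 2}})"
proof -
  \<comment> \<open>The edge is the single vertex with a leaf attached.\<close>
  have "is_path ({1::nat}, {}) u xs w \<longleftrightarrow> u = 1 \<and> w = 1 \<and> xs = [1]" for u w xs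
    by (cases xs rule: rev_cases; cases "butlast xs") (auto simp: is_path_def)
  hence "finite_tree ({1::nat}, {})" by (auto simp: finite_tree_def)
  hence "finite_tree (add_leaf ({1::nat}, {}) 1 2)" by (intro finite_tree_add_leaf) auto
  moreover have "add_leaf ({1::nat}, {}) 1 2 = ({1, 2}, {{1, 2}})" by (auto simp: add_leaf_def)
  ultimately have "finite_tree ({1::nat, 2}, {{1, 2}})" by simp
  moreover have "{e. e = {1::nat, 2} \<and> 1 \<in> e} = {{1, 2}}" "{e. e = {1::nat, 2} \<and> 2 \<in> e} = {{1, 2}}" by auto
  ultimately have "finite_tree ({1::nat, 2}, {{1, 2}})" "vertex_degree ({1, 2}, {{1::nat, 2}}) 1 = 1"
    "vertex_degree ({1, 2}, {{1::nat, 2}}) 2 = 1" by (simp_all add: vertex_degree_def)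
  moreover have "{1..2} = {1::nat, 2}" by auto
  ultimately show ?thesis by (auto simp: grown_def)
qed

lemma grown_add_leaf:
  assumes g: "grown n t" and n: "n \<ge> 1" and v: "v \<in> verts t"
  shows "grown (Suc n) (add_leaf t v (Suc n))"
proof -
  have tree: "finite_tree t" and V: "verts t = {1..n}" using g by (auto simp: grown_def)
  note e = finite_tree_edges[OF tree]
  have new: "Suc n \<notin> verts t" using V by simp
  have "(\<Sum>u\<in>extend v (Suc n) (verts t). vertex_degree (add_leaf t v (Suc n)) u) =
      (\<Sum>u\<in>verts t. vertex_degree t u) + 2"
    using degree_sum_add_leaf[OF e(2,3) v new order_refl e(1)] v by simp
  also have "(\<Sum>u\<in>verts t. vertex_degree t u) = 2 * (n - 1)" using g unfolding grown_def by blast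
  finally have "(\<Sum>u\<in>extend v (Suc n) (verts t). vertex_degree (add_leaf t v (Suc n)) u) = 2 * (n - 1) + 2" .
  moreover have "extend v (Suc n) (verts t) = insert (Suc n) (verts t)" using v by (simp add: extend_def)
  moreover have "insert (Suc n) {1..n} = {1..Suc n}" by auto
  ultimately show ?thesis
    using g n finite_tree_add_leaf[OF tree v new] vertex_degree_add_leaf[OF e(2,3) v new] V
    by (auto simp: grown_def)
qed

text \<open>The root is a leaf at time \<open>k\<close>. As vertices are numbered in the order of arrival, this can be read
off from the tree at any later time.\<close>

definition root_leaf :: "nat \<Rightarrow> nat graph \<Rightarrow> bool" where
  "root_leaf k t \<longleftrightarrow> (\<forall>w \<le> k. {1, w} \<in> edges t \<longrightarrow> w = 2)"

lemma root_leaf_antimono: "root_leaf k t \<Longrightarrow> k' \<le> k \<Longrightarrow> root_leaf k' t"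
  by (auto simp: root_leaf_def)

lemma root_leaf_add_later_leaf:
  assumes "k < n" "1 < n"
  shows "root_leaf k (add_leaf t v n) \<longleftrightarrow> root_leaf k t"
  using assms by (auto simp: root_leaf_def doubleton_eq_iff)

lemma root_leaf_add_leaf:
  assumes g: "grown n t" and n: "n \<ge> 2"
  shows "root_leaf (Suc n) (add_leaf t v (Suc n)) \<longleftrightarrow> root_leaf n t \<and> v \<noteq> 1"
proof -
  have "{1, Suc n} \<notin> edges t" using g finite_tree_edges(3)[of t] by (auto simp: grown_def)
  thus ?thesis using n by (auto simp: root_leaf_def doubleton_eq_iff le_Suc_eq)
qed

lemma root_leaf_pendant:
  assumes g: "grown n t" and q: "root_leaf n t" and n: "n \<ge> 2"
  shows "pendant t {1} 1"
proof (rule pendant_leaf)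
  have tree: "finite_tree t" and V: "verts t = {1..n}" and e12: "{1, 2} \<in> edges t"
    using g by (auto simp: grown_def)
  show "{e \<in> edges t. 1 \<in> e} = {{1, 2}}"
  proof (intro equalityI subsetI)
    fix e assume "e \<in> {e \<in> edges t. 1 \<in> e}"
    hence e: "e \<in> edges t" "1 \<in> e" by auto
    then obtain w where w: "e = {1, w}"
      using finite_tree_edges(4)[OF tree e(1)] by (auto simp: card_2_iff)
    hence "w \<le> n" using finite_tree_edges(3)[OF tree] e(1) V by auto
    thus "e \<in> {{1, 2}}" using q e w by (auto simp: root_leaf_def)
  qed (use e12 in auto)
  show "1 \<in> verts t" "2 \<in> verts t" "(2::nat) \<noteq> 1" using V n by auto
qed

lemma new_leaf_pendant:
  assumes tree: "finite_tree t" and v: "v \<in> verts t" and n: "n \<notin> verts t"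
  shows "pendant (add_leaf t v n) {n} n"
proof (rule pendant_leaf)
  show "{e \<in> edges (add_leaf t v n). n \<in> e} = {{n, v}}"
    using finite_tree_edges(3)[OF tree] n by auto
qed (use v n in auto)

definition weight :: "(nat \<Rightarrow> real) \<Rightarrow> nat graph \<Rightarrow> nat set \<Rightarrow> real" where
  "weight f t U = (\<Sum>v\<in>U. f (vertex_degree t v))"

lemma random_tree_Suc:
  assumes "n \<ge> 2"
  shows "random_tree f (Suc n) =
    bind_pmf (random_tree f n) (\<lambda>t. map_pmf (\<lambda>v. add_leaf t v (Suc n)) (attach_vertex f t))"
proof -
  have "n = Suc (Suc (n - 2))" using assms by simp
  then obtain k where "n = Suc (Suc k)" by blast
  thus ?thesis by (simp add: add_leaf_def numeral_3_eq_3)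
qed

section \<open>Growth with two marked branches\<close>

text \<open>The tree together with the branches that have grown out of \<open>v\<^sub>1\<close> and \<open>v\<^sub>j\<close> since time \<open>j\<close>.\<close>

type_synonym marked_tree = "nat graph \<times> nat set \<times> nat set"

text \<open>The number \<open>k\<close> counts the steps after time \<open>j\<close>.\<close>

fun marked :: "(nat \<Rightarrow> real) \<Rightarrow> nat \<Rightarrow> nat \<Rightarrow> marked_tree pmf" where
  "marked f j 0 = map_pmf (\<lambda>t. (t, {1}, {j})) (random_tree f j)"
| "marked f j (Suc k) = bind_pmf (marked f j k) (\<lambda>(t, A, B).
     map_pmf (\<lambda>v. (add_leaf t v (Suc (j + k)), extend v (Suc (j + k)) A, extend v (Suc (j + k)) B))
       (attach_vertex f t))"

lemma map_fst_marked:
  assumes "j \<ge> 2"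
  shows "map_pmf fst (marked f j k) = random_tree f (j + k)"
proof (induction k)
  case 0
  show ?case by (simp add: map_pmf_comp)
next
  case (Suc k)
  have "random_tree f (Suc (j + k)) = bind_pmf (map_pmf fst (marked f j k))
      (\<lambda>t. map_pmf (\<lambda>v. add_leaf t v (Suc (j + k))) (attach_vertex f t))"
    using assms Suc.IH by (subst random_tree_Suc) simp_all
  thus ?case by (simp add: map_bind_pmf bind_map_pmf map_pmf_comp case_prod_unfold)
qed

text \<open>The two bounds make every branch attract new vertices at a rate that is proportional to its size,
up to constants.\<close>

locale attachment =
  fixes f :: "nat \<Rightarrow> real" and lo hi :: real
  assumes lo_pos: "lo > 0" and f_ge: "\<And>i. i \<ge> 1 \<Longrightarrow> lo \<le> f i" and f_le: "\<And>i. i \<ge> 1 \<Longrightarrow> f i \<le> hi * real i"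
begin

lemma f_pos: "i \<ge> 1 \<Longrightarrow> f i > 0"
  using lo_pos f_ge[of i] by linarith

lemma hi_pos: "hi > 0"
  using f_pos[of 1] f_le[of 1] by simp

lemma weight_ge:
  assumes g: "grown n t" and U: "U \<subseteq> verts t"
  shows "weight f t U \<ge> lo * card U"
proof -
  have "(\<Sum>v\<in>U. lo) \<le> weight f t U" unfolding weight_def
    using g U by (intro sum_mono f_ge) (auto simp: grown_def)
  thus ?thesis by (simp add: mult.commute)
qed

lemma weight_le:
  assumes g: "grown n t" and U: "U \<subseteq> verts t"
  shows "weight f t U \<le> hi * real (\<Sum>v\<in>U. vertex_degree t v)"
proof -
  have "weight f t U \<le> (\<Sum>v\<in>U. hi * real (vertex_degree t v))" unfolding weight_def
    using g U by (intro sum_mono f_le) (auto simp: grown_def)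
  thus ?thesis by (simp add: sum_distrib_left)
qed

lemma weight_total_pos: "grown n t \<Longrightarrow> n \<ge> 1 \<Longrightarrow> weight f t (verts t) > 0"
  using weight_ge[of n t "verts t"] lo_pos by (auto simp: grown_def intro: less_le_trans[rotated])

lemma pmf_attach:
  assumes g: "grown n t" and n: "n \<ge> 1"
  shows "pmf (attach_vertex f t) v = (if v \<in> verts t then f (vertex_degree t v) / weight f t (verts t) else 0)"
  unfolding weight_def using g n f_pos by (intro pmf_attach_vertex) (auto simp: grown_def)

lemma set_attach:
  assumes g: "grown n t" and n: "n \<ge> 1"
  shows "set_pmf (attach_vertex f t) = verts t"
proof -
  have "v \<in> set_pmf (attach_vertex f t) \<longleftrightarrow> v \<in> verts t" for v
    using pmf_attach[OF g n, of v] weight_total_pos[OF g n] f_pos[of "vertex_degree t v"] g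
    by (auto simp: set_pmf_iff grown_def)
  thus ?thesis by blast
qed

lemma prob_attach:
  assumes g: "grown n t" and n: "n \<ge> 1" and U: "U \<subseteq> verts t"
  shows "measure_pmf.prob (attach_vertex f t) U = weight f t U / weight f t (verts t)"
proof -
  have "finite U" using g U finite_subset by (auto simp: grown_def)
  hence "measure_pmf.prob (attach_vertex f t) U = (\<Sum>v\<in>U. pmf (attach_vertex f t) v)"
    by (rule measure_measure_pmf_finite)
  also have "\<dots> = (\<Sum>v\<in>U. f (vertex_degree t v) / weight f t (verts t))"
    using U pmf_attach[OF g n] by (intro sum.cong) auto
  finally show ?thesis by (simp add: weight_def sum_divide_distrib)
qed

lemma random_tree_grown: "n \<ge> 2 \<Longrightarrow> t \<in> set_pmf (random_tree f n) \<Longrightarrow> grown n t"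
proof (induction n arbitrary: t rule: dec_induct)
  case base
  thus ?case using grown_2 by (simp add: numeral_2_eq_2)
next
  case (step n)
  then obtain t' v where t': "t' \<in> set_pmf (random_tree f n)" "v \<in> set_pmf (attach_vertex f t')"
    and t: "t = add_leaf t' v (Suc n)"
    by (auto simp: random_tree_Suc)
  have "grown n t'" using step.IH t'(1) .
  thus ?case using t'(2) t step.hyps set_attach[of n t'] by (auto intro!: grown_add_leaf)
qed

lemma finite_random_tree: "n \<ge> 2 \<Longrightarrow> finite (set_pmf (random_tree f n))"
proof (induction n rule: dec_induct)
  case base
  thus ?case by (simp add: numeral_2_eq_2)
next
  case (step n)
  have "finite (set_pmf (attach_vertex f t))" if "t \<in> set_pmf (random_tree f n)" for t
  proof -
    have "grown n t" using random_tree_grown[OF step.hyps(1) that] .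
    thus ?thesis using set_attach[of n t] step.hyps grown_finite by simp
  qed
  thus ?case using step by (simp add: random_tree_Suc)
qed

lemma marked_grown: "j \<ge> 2 \<Longrightarrow> (t, A, B) \<in> set_pmf (marked f j k) \<Longrightarrow> grown (j + k) t"
  using map_fst_marked[of j f k] random_tree_grown[of "j + k" t]
  by (metis (no_types, lifting) fst_conv image_eqI set_map_pmf trans_le_add1)

lemma finite_marked: "j \<ge> 2 \<Longrightarrow> finite (set_pmf (marked f j k))"
proof (induction k)
  case 0
  thus ?case using finite_random_tree by simp
next
  case (Suc k)
  have "finite (set_pmf (attach_vertex f t))" if "(t, A, B) \<in> set_pmf (marked f j k)" for t A B
  proof -
    have "grown (j + k) t" using marked_grown[OF Suc.prems that] .
    thus ?thesis using set_attach[of "j + k" t] Suc.prems grown_finite by simp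
  qed
  thus ?case using Suc by auto
qed

lemma marked_pendant:
  assumes j: "j \<ge> 3"
  shows "(t, A, B) \<in> set_pmf (marked f j k) \<Longrightarrow> root_leaf j t \<Longrightarrow>
    pendant t A 1 \<and> pendant t B j \<and> A \<inter> B = {}"
proof (induction k arbitrary: t A B)
  case 0
  hence t: "t \<in> set_pmf (random_tree f j)" and AB: "A = {1}" "B = {j}" by auto
  obtain i where i: "j = Suc i" "i \<ge> 2" using j by (cases j) auto
  then obtain t' v where t': "t' \<in> set_pmf (random_tree f i)" "v \<in> set_pmf (attach_vertex f t')"
    and tt': "t = add_leaf t' v j"
    using t by (auto simp: random_tree_Suc)
  have g': "grown i t'" using random_tree_grown i t' by blast
  have "pendant t {1} 1" using root_leaf_pendant[of j t] random_tree_grown[of j t] t j 0 by simp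
  moreover have "pendant t {j} j" unfolding tt'
    using g' t'(2) set_attach[OF g'] i by (intro new_leaf_pendant) (auto simp: grown_def)
  ultimately show ?case using AB j by simp
next
  case (Suc k)
  then obtain t' A' B' v where s': "(t', A', B') \<in> set_pmf (marked f j k)"
      "v \<in> set_pmf (attach_vertex f t')"
    and t: "t = add_leaf t' v (Suc (j + k))" "A = extend v (Suc (j + k)) A'" "B = extend v (Suc (j + k)) B'"
    by auto
  have g': "grown (j + k) t'" using marked_grown[OF _ s'(1)] j by simp
  have v: "v \<in> verts t'" using s'(2) set_attach[OF g'] j by simp
  have new: "Suc (j + k) \<notin> verts t'" and tree: "finite_tree t'" using g' by (auto simp: grown_def)
  have "root_leaf j t'" using Suc.prems(2) t root_leaf_add_later_leaf[of j "Suc (j + k)"] j by simp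
  with Suc.IH[OF s'(1)] have IH: "pendant t' A' 1" "pendant t' B' j" "A' \<inter> B' = {}" by auto
  have "A' \<subseteq> verts t'" "B' \<subseteq> verts t'" using IH by (auto simp: pendant_def branch_def)
  hence "A \<inter> B = {}" using IH(3) new v unfolding t extend_def by auto
  thus ?case using pendant_extend[OF IH(1) tree v new] pendant_extend[OF IH(2) tree v new] t by simp
qed

text \<open>The attachment law depends on the tree only through the degrees.\<close>

lemma attach_vertex_bij:
  assumes g: "grown n t" "grown n t'" and n: "n \<ge> 1"
    and bij: "bij_betw \<tau> (verts t) (verts t')"
    and deg: "\<And>v. v \<in> verts t \<Longrightarrow> vertex_degree t' (\<tau> v) = vertex_degree t v"
  shows "attach_vertex f t' = map_pmf \<tau> (attach_vertex f t)"
proof (rule pmf_eqI)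
  fix v'
  have set: "set_pmf (attach_vertex f t) = verts t" using set_attach[OF g(1) n] .
  have inj: "inj_on \<tau> (verts t)" and im: "\<tau> ` verts t = verts t'" using bij by (auto simp: bij_betw_def)
  have W: "weight f t' (verts t') = weight f t (verts t)"
    unfolding weight_def using sum.reindex_bij_betw[OF bij, of "\<lambda>v. f (vertex_degree t' v)"] deg by simp
  show "pmf (attach_vertex f t') v' = pmf (map_pmf \<tau> (attach_vertex f t)) v'"
  proof (cases "v' \<in> verts t'")
    case True
    then obtain v where v: "v \<in> verts t" "v' = \<tau> v" using im by blast
    have "pmf (map_pmf \<tau> (attach_vertex f t)) v' = pmf (attach_vertex f t) v"
      unfolding v(2) using inj v(1) by (intro pmf_map_inj) (auto simp: set)
    thus ?thesis using pmf_attach[OF g(1) n, of v] pmf_attach[OF g(2) n, of v'] v True W deg by simp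
  next
    case False
    hence "v' \<notin> set_pmf (map_pmf \<tau> (attach_vertex f t))" using im set by auto
    hence "pmf (map_pmf \<tau> (attach_vertex f t)) v' = 0" by (simp add: set_pmf_iff del: set_map_pmf)
    thus ?thesis using False pmf_attach[OF g(2) n, of v'] by simp
  qed
qed

text \<open>Two marked trees are mirror images if a bijection of the vertices preserves the degrees and exchanges
the two marked branches. It need not respect the edges, since the degrees alone drive the growth.\<close>

definition mirror :: "nat \<Rightarrow> marked_tree \<Rightarrow> marked_tree \<Rightarrow> bool" where
  "mirror n = (\<lambda>(t, A, B) (t', A', B'). grown n t \<and> grown n t' \<and>
     A \<subseteq> verts t \<and> B \<subseteq> verts t \<and> A' \<subseteq> verts t' \<and> B' \<subseteq> verts t' \<and>
     (\<exists>\<tau>. bij_betw \<tau> (verts t) (verts t') \<and>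
       (\<forall>v \<in> verts t. vertex_degree t' (\<tau> v) = vertex_degree t v \<and> (\<tau> v \<in> A' \<longleftrightarrow> v \<in> B) \<and> (\<tau> v \<in> B' \<longleftrightarrow> v \<in> A))))"

lemma mirror_card:
  assumes "mirror n (t, A, B) (t', A', B')"
  shows "card A' = card B \<and> card B' = card A"
proof -
  obtain \<tau> where \<tau>: "bij_betw \<tau> (verts t) (verts t')"
    and AB: "\<And>v. v \<in> verts t \<Longrightarrow> \<tau> v \<in> A' \<longleftrightarrow> v \<in> B" "\<And>v. v \<in> verts t \<Longrightarrow> \<tau> v \<in> B' \<longleftrightarrow> v \<in> A"
    and sub: "A \<subseteq> verts t" "B \<subseteq> verts t" "A' \<subseteq> verts t'" "B' \<subseteq> verts t'"
    using assms by (auto simp: mirror_def)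
  have inj: "inj_on \<tau> (verts t)" and im: "verts t' = \<tau> ` verts t" using \<tau> by (auto simp: bij_betw_def)
  have "A' = \<tau> ` B" "B' = \<tau> ` A" using sub(1,2) AB sub(3,4)[unfolded im] by blast+
  thus ?thesis
    using card_image inj_on_subset[OF inj sub(1)] inj_on_subset[OF inj sub(2)] by blast
qed

text \<open>Attaching the new vertex at \<open>v\<close> in one tree and at \<open>\<tau> v\<close> in the other couples the two
steps so that the trees remain mirror images.\<close>

lemma mirror_attach:
  assumes m: "mirror n (t, A, B) (t', A', B')" and n: "n \<ge> 1"
  defines "next v \<equiv> (add_leaf t v (Suc n), extend v (Suc n) A, extend v (Suc n) B)"
    and "next' v \<equiv> (add_leaf t' v (Suc n), extend v (Suc n) A', extend v (Suc n) B')"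
  shows "rel_pmf (mirror (Suc n)) (map_pmf next (attach_vertex f t)) (map_pmf next' (attach_vertex f t'))"
proof -
  obtain \<tau> where \<tau>: "bij_betw \<tau> (verts t) (verts t')"
    and deg: "\<And>v. v \<in> verts t \<Longrightarrow> vertex_degree t' (\<tau> v) = vertex_degree t v"
    and AB: "\<And>v. v \<in> verts t \<Longrightarrow> \<tau> v \<in> A' \<longleftrightarrow> v \<in> B" "\<And>v. v \<in> verts t \<Longrightarrow> \<tau> v \<in> B' \<longleftrightarrow> v \<in> A"
    and sub: "A \<subseteq> verts t" "B \<subseteq> verts t" "A' \<subseteq> verts t'" "B' \<subseteq> verts t'"
    and g: "grown n t" "grown n t'"
    using m by (auto simp: mirror_def)
  have new: "Suc n \<notin> verts t" "Suc n \<notin> verts t'" using g by (auto simp: grown_def)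
  have tree: "finite_tree t" "finite_tree t'" using g by (auto simp: grown_def)
  have "mirror (Suc n) (next v) (next' (\<tau> v))" if v: "v \<in> verts t" for v
  proof -
    have v': "\<tau> v \<in> verts t'" using v \<tau> by (auto simp: bij_betw_def)
    note deg1 = vertex_degree_add_leaf[OF finite_tree_edges(2,3)[OF tree(1)] v new(1)]
    note deg2 = vertex_degree_add_leaf[OF finite_tree_edges(2,3)[OF tree(2)] v' new(2)]
    define \<sigma> where "\<sigma> = \<tau>(Suc n := Suc n)"
    have "bij_betw \<sigma> (verts t) (verts t')"
      using \<tau> new by (subst bij_betw_cong[where g = \<tau>]) (auto simp: \<sigma>_def)
    hence "bij_betw \<sigma> (insert (Suc n) (verts t)) (insert (Suc n) (verts t'))"
      using notIn_Un_bij_betw[of "Suc n" "verts t" \<sigma> "verts t'"] new by (simp add: \<sigma>_def)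
    moreover have "vertex_degree (add_leaf t' (\<tau> v) (Suc n)) (\<sigma> u) = vertex_degree (add_leaf t v (Suc n)) u \<and>
        (\<sigma> u \<in> extend (\<tau> v) (Suc n) A' \<longleftrightarrow> u \<in> extend v (Suc n) B) \<and>
        (\<sigma> u \<in> extend (\<tau> v) (Suc n) B' \<longleftrightarrow> u \<in> extend v (Suc n) A)" if u: "u \<in> insert (Suc n) (verts t)" for u
    proof (cases "u = Suc n")
      case True
      have "Suc n \<notin> A \<union> B" "Suc n \<notin> A' \<union> B'" using sub new by auto
      thus ?thesis using True AB[OF v] by (simp add: \<sigma>_def extend_def deg1 deg2)
    next
      case False
      hence u: "u \<in> verts t" using u by simp
      hence "\<tau> u \<noteq> Suc n" using bij_betwE[OF \<tau>] new(2) by metis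
      moreover have "\<tau> u = \<tau> v \<longleftrightarrow> u = v" using \<tau> u v by (auto simp: bij_betw_def inj_on_def)
      ultimately show ?thesis
        using AB[OF u] AB[OF v] False deg[OF u] deg[OF v] by (simp add: \<sigma>_def extend_def deg1 deg2)
    qed
    moreover have "extend v (Suc n) U \<subseteq> insert (Suc n) W" if "U \<subseteq> W" for v U and W :: "nat set"
      using that by (auto simp: extend_def)
    ultimately show ?thesis
      using grown_add_leaf[OF g(1) n v] grown_add_leaf[OF g(2) n v'] sub
      unfolding mirror_def next_def next'_def by auto
  qed
  moreover have "attach_vertex f t' = map_pmf \<tau> (attach_vertex f t)"
    by (rule attach_vertex_bij[OF g n \<tau>]) (rule deg)
  ultimately show ?thesis
    by (auto simp: pmf.rel_map set_attach[OF g(1) n] intro!: rel_pmf_reflI)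
qed

text \<open>At time \<open>j\<close> the marked tree is its own mirror image under the transposition of the two leaves,
and the coupling of the steps preserves this. If the root is not a leaf at time \<open>j\<close>,
the relation is equality, so that it can be coupled as well.\<close>

lemma marked_symmetric:
  assumes j: "j \<ge> 3"
  defines "R n \<equiv> (\<lambda>s s'. (root_leaf j (fst s) \<longrightarrow> mirror n s s') \<and> (root_leaf j (fst s) \<longleftrightarrow> root_leaf j (fst s')) \<and>
     (\<not> root_leaf j (fst s) \<longrightarrow> s = s'))"
  shows "rel_pmf (R (j + k)) (marked f j k) (marked f j k)"
proof (induction k)
  case 0
  have "R j (t, {1}, {j}) (t, {1}, {j})" if t: "t \<in> set_pmf (random_tree f j)" for t
  proof -
    have "mirror j (t, {1}, {j}) (t, {1}, {j})" if q: "root_leaf j t"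
    proof -
      define \<tau> where "\<tau> = Transposition.transpose 1 j"
      have g: "grown j t" using random_tree_grown[of j t] t j by simp
      have "(t, {1}, {j}) \<in> set_pmf (marked f j 0)" using t by simp
      from marked_pendant[OF j this q] have "vertex_degree t 1 = vertex_degree t j" 
        by (auto simp: pendant_def)
      hence "vertex_degree t (\<tau> v) = vertex_degree t v" for v
        by (auto simp: \<tau>_def Transposition.transpose_def)
      moreover have "bij_betw \<tau> (verts t) (verts t)"
        unfolding \<tau>_def using g j by (intro permutes_imp_bij permutes_swap_id) (auto simp: grown_def)
      moreover have "\<tau> v = 1 \<longleftrightarrow> v = j" "\<tau> v = j \<longleftrightarrow> v = 1" for v by (auto simp: \<tau>_def Transposition.transpose_def)
      ultimately show ?thesis using g j unfolding mirror_def by (auto simp: grown_def)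
    qed
    thus ?thesis by (simp add: R_def)
  qed
  thus ?case by (auto simp: pmf.rel_map intro!: rel_pmf_reflI)
next
  case (Suc k)
  let ?next = "\<lambda>t A B v. (add_leaf t v (Suc (j + k)), extend v (Suc (j + k)) A, extend v (Suc (j + k)) B)"
  have q: "root_leaf j (add_leaf t v (Suc (j + k))) \<longleftrightarrow> root_leaf j t" for t v
    using root_leaf_add_later_leaf[of j "Suc (j + k)"] j by simp
  have step: "rel_pmf (R (Suc (j + k))) (map_pmf (?next t A B) (attach_vertex f t))
      (map_pmf (?next t' A' B') (attach_vertex f t'))"
    if "R (j + k) (t, A, B) (t', A', B')" for t A B t' A' B'
  proof (cases "root_leaf j t")
    case True
    hence "mirror (j + k) (t, A, B) (t', A', B')" "root_leaf j t'" using that by (auto simp: R_def)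
    from mirror_attach[OF this(1)] this(2) True j show ?thesis
      unfolding pmf.rel_map by (auto simp: R_def q elim!: pmf.rel_mono_strong)
  next
    case False
    thus ?thesis using that
      unfolding pmf.rel_map by (auto simp: R_def q intro!: rel_pmf_reflI)
  qed
  show ?case unfolding marked.simps add_Suc_right
    by (rule rel_pmf_bindI[OF Suc.IH]) (use step in auto)
qed

end

section \<open>Expectations over finitely many outcomes\<close>

lemma expectation_bind_pmf_finite:
  fixes h :: "'b \<Rightarrow> real"
  assumes fin: "finite (set_pmf p)" and finK: "\<And>x. x \<in> set_pmf p \<Longrightarrow> finite (set_pmf (K x))"
  shows "measure_pmf.expectation (bind_pmf p K) h =
    measure_pmf.expectation p (\<lambda>x. measure_pmf.expectation (K x) h)"
proof -
  have "measure_pmf.expectation (bind_pmf p K) h =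
      (\<Sum>x\<in>set_pmf p. pmf p x *\<^sub>R measure_pmf.expectation (K x) h)"
    by (rule pmf_expectation_bind) (use fin finK in auto)
  also have "\<dots> = measure_pmf.expectation p (\<lambda>x. measure_pmf.expectation (K x) h)"
    by (rule integral_measure_pmf[OF fin, symmetric]) auto
  finally show ?thesis .
qed

lemma prob_eq_expectation: "measure_pmf.prob p {x. P x} = measure_pmf.expectation p (\<lambda>x. of_bool (P x))"
proof -
  have "(\<lambda>x. of_bool (P x) :: real) = indicator {x. P x}" by (auto simp: indicator_def)
  thus ?thesis by simp
qed

lemma prob_True_eq_expectation: "measure_pmf.prob p {True} = measure_pmf.expectation p of_bool"
proof -
  have "{b. b} = {True}" by auto
  thus ?thesis using prob_eq_expectation[of p "\<lambda>b. b"] by simp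
qed

lemma expectation_mono_finite:
  fixes g h :: "'a \<Rightarrow> real"
  assumes "finite (set_pmf p)" "\<And>x. x \<in> set_pmf p \<Longrightarrow> g x \<le> h x"
  shows "measure_pmf.expectation p g \<le> measure_pmf.expectation p h"
  using assms by (intro integral_mono_AE integrable_measure_pmf_finite AE_pmfI)

text \<open>Losing at least \<open>\<kappa> / n\<close> in every step would bound the harmonic series.\<close>

lemma harmonic_drift:
  fixes \<Phi> x :: "nat \<Rightarrow> real"
  assumes nonneg: "\<And>n. \<Phi> n \<ge> 0" and drift: "\<And>n. n \<ge> n0 \<Longrightarrow> \<Phi> (Suc n) \<le> \<Phi> n - x n / real n"
    and \<kappa>: "\<kappa> > 0"
  shows "\<exists>n \<ge> n1. x n \<le> \<kappa>"
proof (rule ccontr)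
  assume "\<not> (\<exists>n \<ge> n1. x n \<le> \<kappa>)"
  hence large: "x n > \<kappa>" if "n \<ge> n1" for n using that by force
  define m where "m = n0 + n1"
  have bound: "\<Phi> (k + m) \<le> \<Phi> m - \<kappa> * (\<Sum>i<k. 1 / real (i + m))" for k
  proof (induction k)
    case (Suc k)
    have "\<kappa> / real (k + m) \<le> x (k + m) / real (k + m)"
      using large[of "k + m"] by (intro divide_right_mono) (auto simp: m_def)
    moreover have "\<Phi> (Suc (k + m)) \<le> \<Phi> (k + m) - x (k + m) / real (k + m)"
      by (intro drift) (simp add: m_def)
    ultimately show ?case using Suc.IH by (simp add: algebra_simps)
  qed simp
  have "summable (\<lambda>i. 1 / real (i + m))"
  proof (rule bounded_imp_summable)
    fix k
    have "\<kappa> * (\<Sum>i\<le>k. 1 / real (i + m)) \<le> \<Phi> m"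
      using bound[of "Suc k"] nonneg[of "Suc k + m"] by (simp add: lessThan_Suc_atMost)
    thus "(\<Sum>i\<le>k. 1 / real (i + m)) \<le> \<Phi> m / \<kappa>" using \<kappa> by (simp add: field_simps)
  qed simp
  hence "summable (\<lambda>i. 1 / real i)" using summable_iff_shift[of "\<lambda>i. 1 / real i" m] by simp
  thus False using not_summable_harmonic[where 'a = real] by (simp add: inverse_eq_divide)
qed

context attachment
begin

section \<open>How long the root stays a leaf\<close>

definition survival :: "nat \<Rightarrow> real" where
  "survival k = measure_pmf.prob (random_tree f k) {t. root_leaf k t}"

lemma root_leaf_in_later_tree:
  assumes "2 \<le> k" "k \<le> n"
  shows "map_pmf (root_leaf k) (random_tree f n) = map_pmf (root_leaf k) (random_tree f k)"
  using assms(2)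
proof (induction n rule: dec_induct)
  case (step n)
  thus ?case using assms(1)
    by (simp add: random_tree_Suc map_bind_pmf map_pmf_comp root_leaf_add_later_leaf map_pmf_const)
       (simp add: map_pmf_def)
qed simp

lemma prob_root_leaf_later:
  assumes "2 \<le> k" "k \<le> n"
  shows "measure_pmf.prob (random_tree f n) {t. root_leaf k t} = survival k"
proof -
  have "measure_pmf.prob (random_tree f m) {t. root_leaf k t} = measure_pmf.prob (map_pmf (root_leaf k) (random_tree f m)) {True}" for m
    by (simp add: measure_map_pmf vimage_def)
  thus ?thesis using root_leaf_in_later_tree[OF assms] unfolding survival_def by metis
qed

lemma survival_Suc:
  assumes k: "k \<ge> 2" and \<sigma>: "\<sigma> > 0"
    and W: "\<And>t. grown k t \<Longrightarrow> root_leaf k t \<Longrightarrow> \<sigma> \<le> weight f t (verts t)"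
  shows "(1 - f 1 / \<sigma>) * survival k \<le> survival (Suc k)"
proof -
  let ?T = "random_tree f k"
  have fin: "finite (set_pmf ?T)" using finite_random_tree k .
  have g: "grown k t" if "t \<in> set_pmf ?T" for t using random_tree_grown[OF k that] .
  have "(1 - f 1 / \<sigma>) * survival k = measure_pmf.expectation ?T (\<lambda>t. (1 - f 1 / \<sigma>) * of_bool (root_leaf k t))"
    by (simp add: survival_def prob_eq_expectation)
  also have "\<dots> \<le> measure_pmf.expectation ?T (\<lambda>t. measure_pmf.expectation
      (map_pmf (\<lambda>v. add_leaf t v (Suc k)) (attach_vertex f t)) (\<lambda>t. of_bool (root_leaf (Suc k) t)))"
  proof (rule expectation_mono_finite[OF fin])
    fix t assume t: "t \<in> set_pmf ?T"
    show "(1 - f 1 / \<sigma>) * of_bool (root_leaf k t) \<le> measure_pmf.expectation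
      (map_pmf (\<lambda>v. add_leaf t v (Suc k)) (attach_vertex f t)) (\<lambda>t. of_bool (root_leaf (Suc k) t))"
    proof (cases "root_leaf k t")
      case True
      have "vertex_degree t 1 = 1" using root_leaf_pendant[OF g[OF t] True k] by (simp add: pendant_def)
      moreover have "1 \<in> verts t" using g[OF t] k by (simp add: grown_def)
      ultimately have "pmf (attach_vertex f t) 1 = f 1 / weight f t (verts t)"
        using pmf_attach[OF g[OF t]] k by simp
      also have "\<dots> \<le> f 1 / \<sigma>" using W[OF g[OF t] True] \<sigma> f_pos[of 1] by (intro divide_left_mono) auto
      finally have "1 - f 1 / \<sigma> \<le> 1 - measure_pmf.prob (attach_vertex f t) {1}" by (simp add: measure_pmf_single)
      also have "\<dots> = measure_pmf.prob (attach_vertex f t) {v. v \<noteq> 1}"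
        using measure_pmf.prob_compl[of "{1}" "attach_vertex f t"] by (simp add: Compl_eq_Diff_UNIV[symmetric] Compl_eq)
      finally show ?thesis using True by (simp add: prob_eq_expectation root_leaf_add_leaf[OF g[OF t] k])
    qed simp
  qed
  also have "\<dots> = survival (Suc k)"
    unfolding survival_def prob_eq_expectation random_tree_Suc[OF k]
    using k by (subst expectation_bind_pmf_finite[OF fin]) (auto simp: set_attach[OF g] grown_finite[OF g])
  finally show ?thesis .
qed

text \<open>The decay estimate below starts only at some \<open>k > B\<close>; positivity covers the steps before.\<close>

lemma survival_pos: "k \<ge> 2 \<Longrightarrow> survival k > 0"
proof (induction k rule: dec_induct)
  case base
  have "survival 2 = 1" by (auto simp: survival_def numeral_2_eq_2 root_leaf_def doubleton_eq_iff indicator_def)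
  thus ?case by simp
next
  case (step k)
  \<comment> \<open>The root has weight \<open>f 1\<close>, and there is at least one other vertex.\<close>
  have "f 1 + lo \<le> weight f t (verts t)" if g: "grown k t" and q: "root_leaf k t" for t
  proof -
    have V: "verts t = insert 1 (verts t - {1})" "finite (verts t)" using g step.hyps by (auto simp: grown_def)
    have "card (verts t - {1}) = k - 1" using g step.hyps by (simp add: grown_def)
    hence "lo * 1 \<le> lo * card (verts t - {1})" using step.hyps lo_pos by (intro mult_left_mono) auto
    also have "\<dots> \<le> weight f t (verts t - {1})" using weight_ge[OF g] by auto
    moreover have "vertex_degree t 1 = 1" using root_leaf_pendant[OF g q] step.hyps by (simp add: pendant_def)
    moreover have "weight f t (verts t) = f (vertex_degree t 1) + weight f t (verts t - {1})"
      unfolding weight_def using V by (subst V(1), subst sum.insert) auto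
    ultimately show ?thesis by simp
  qed
  moreover have "f 1 + lo > 0" "1 - f 1 / (f 1 + lo) > 0" using f_pos[of 1] lo_pos by (auto simp: field_simps)
  ultimately show ?case using survival_Suc[OF step.hyps(1), of "f 1 + lo"] step.IH
    by (metis less_le_trans mult_pos_pos)
qed

text \<open>The survival probability is bounded below by a power law, in the form that
\<open>survival k * (k - B) powr \<gamma>\<close> with \<open>\<gamma> = f 1 / g\<close> is nondecreasing for \<open>k > B\<close>. The shift \<open>B\<close>
makes this exact: with \<open>\<eta> = h / g\<close> and \<open>B = 1 + \<eta> + \<gamma>\<close> one has
\<open>(1 - 1 / (k + 1 - B)) powr \<gamma> \<le> exp (- \<gamma> / (k - \<eta> - \<gamma>)) \<le> 1 - \<gamma> / (k - \<eta>)\<close>.\<close>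

lemma survival_decay:
  assumes g: "g > 0" and h: "h \<ge> 0"
    and W: "\<And>n t. grown n t \<Longrightarrow> n \<ge> 2 \<Longrightarrow> g * real n - h \<le> weight f t (verts t)"
  shows "\<exists>B \<ge> 1. \<forall>k m. B < real k \<longrightarrow> k \<le> m \<longrightarrow>
    survival k * ((real k - B) / (real m - B)) powr (f 1 / g) \<le> survival m"
proof -
  define \<gamma> \<eta> where "\<gamma> = f 1 / g" and "\<eta> = h / g"
  define B where "B = 1 + \<eta> + \<gamma>"
  have \<gamma>: "\<gamma> > 0" and \<eta>: "\<eta> \<ge> 0" using f_pos[of 1] g h by (auto simp: \<gamma>_def \<eta>_def)
  have step: "survival k * ((real k - B) / (real (Suc k) - B)) powr \<gamma> \<le> survival (Suc k)" if k: "B < real k" for k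
  proof -
    have k2: "k \<ge> 2" using k \<gamma> \<eta> by (simp add: B_def)
    have pos: "real k - B > 0" "real k - \<eta> > \<gamma>" using k by (auto simp: B_def)
    define z where "z = (real k - B) / (real (Suc k) - B)"
    have z: "z > 0" "z - 1 = - 1 / (real (Suc k) - B)" using pos by (auto simp: z_def field_simps)
    have "z powr \<gamma> = exp (\<gamma> * ln z)" using z by (simp add: powr_def)
    also have "\<dots> \<le> exp (\<gamma> * (z - 1))" using ln_le_minus_one[OF z(1)] \<gamma> by simp
    also have "\<dots> = exp (- (\<gamma> / (real k - \<eta> - \<gamma>)))" unfolding z(2) by (simp add: B_def algebra_simps)
    also have "\<dots> \<le> 1 - \<gamma> / (real k - \<eta>)"
    proof -
      have "(real k - \<eta>) / (real k - \<eta> - \<gamma>) = 1 + \<gamma> / (real k - \<eta> - \<gamma>)" using pos by (simp add: field_simps)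
      also have "\<dots> \<le> exp (\<gamma> / (real k - \<eta> - \<gamma>))" by (rule exp_ge_add_one_self)
      finally have "inverse (exp (\<gamma> / (real k - \<eta> - \<gamma>))) \<le> inverse ((real k - \<eta>) / (real k - \<eta> - \<gamma>))"
        using pos \<gamma> by (intro le_imp_inverse_le) auto
      also have "\<dots> = 1 - \<gamma> / (real k - \<eta>)" using pos \<gamma> by (simp add: field_simps)
      finally show ?thesis by (simp add: exp_minus)
    qed
    also have "\<gamma> / (real k - \<eta>) = f 1 / (g * real k - h)" using g pos by (simp add: \<gamma>_def \<eta>_def field_simps)
    finally have zle: "z powr \<gamma> \<le> 1 - f 1 / (g * real k - h)" .
    have "h / g < real k" using pos(2) \<gamma> by (simp add: \<eta>_def)
    hence "g * real k - h > 0" using g by (simp add: field_simps)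
    from survival_Suc[OF k2 this] W k2 have "(1 - f 1 / (g * real k - h)) * survival k \<le> survival (Suc k)" by blast
    moreover have "z powr \<gamma> * survival k \<le> (1 - f 1 / (g * real k - h)) * survival k"
      using zle survival_pos[OF k2] by (intro mult_right_mono) auto
    ultimately show ?thesis by (simp add: z_def mult.commute)
  qed
  have "survival k * ((real k - B) / (real m - B)) powr \<gamma> \<le> survival m" if k: "B < real k" and m: "k \<le> m" for k m
    using m
  proof (induction m rule: dec_induct)
    case base
    show ?case using k by simp
  next
    case (step m)
    \<comment> \<open>The ratios telescope.\<close>
    let ?q = "\<lambda>a b. (real a - B) / (real b - B)"
    have Bm: "B < real m" using k step.hyps by linarith
    have cancel: "a / c = (a / b) * (b / c)" if "b \<noteq> 0" for a b c :: real using that by simp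
    have eq: "?q k (Suc m) = ?q k m * ?q m (Suc m)" using Bm by (intro cancel) simp
    have "?q k (Suc m) powr \<gamma> = ?q k m powr \<gamma> * ?q m (Suc m) powr \<gamma>"
      unfolding eq by (rule powr_mult)
    hence "survival k * ?q k (Suc m) powr \<gamma> = (survival k * ?q k m powr \<gamma>) * ?q m (Suc m) powr \<gamma>"
      by (simp only: mult.assoc)
    also have "\<dots> \<le> survival m * ?q m (Suc m) powr \<gamma>" using step.IH by (intro mult_right_mono) auto
    also have "\<dots> \<le> survival (Suc m)" by (rule \<open>\<And>k. B < real k \<Longrightarrow> _\<close>[OF Bm])
    finally show ?case .
  qed
  moreover have "B \<ge> 1" using \<gamma> \<eta> by (simp add: B_def)
  ultimately show ?thesis unfolding \<gamma>_def by blast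
qed

section \<open>Ties between the two branches do not persist\<close>

definition tie :: "nat \<Rightarrow> marked_tree \<Rightarrow> bool" where
  "tie j = (\<lambda>(t, A, B). root_leaf j t \<and> card A = card B)"

definition nontie :: "nat \<Rightarrow> marked_tree \<Rightarrow> bool" where
  "nontie j = (\<lambda>(t, A, B). root_leaf j t \<and> card A \<noteq> card B)"

definition potential :: "nat \<Rightarrow> marked_tree \<Rightarrow> real" where
  "potential j = (\<lambda>(t, A, B). of_bool (tie j (t, A, B)) / (real (card A) + real (card B)))"

lemma potential_nonneg: "0 \<le> potential j s"
  by (cases s) (simp add: potential_def)

text \<open>The upper bound uses that the degrees in the branches sum to less than \<open>2 * N\<close>, the lower bound
that the degrees in the tree sum to less than \<open>2 * (j + k)\<close>.\<close>

lemma prob_hit_branches: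
  assumes j: "j \<ge> 3" and s: "(t, A, B) \<in> set_pmf (marked f j k)" and q: "root_leaf j t"
  defines "N \<equiv> real (card A) + real (card B)" and "p \<equiv> measure_pmf.prob (attach_vertex f t) (A \<union> B)"
  shows "lo / (2 * hi) * N / real (j + k) \<le> p" "p \<le> 2 * hi / lo * N / real (j + k)" "N \<ge> 2"
proof -
  let ?n = "j + k" and ?deg = "vertex_degree t"
  have g: "grown ?n t" using marked_grown[OF _ s] j by simp
  have pd: "pendant t A 1" "pendant t B j" and disj: "A \<inter> B = {}" using marked_pendant[OF j s q] by auto
  have sub: "A \<subseteq> verts t" "B \<subseteq> verts t" and ne: "A \<noteq> {}" "B \<noteq> {}" using pd by (auto simp: pendant_def branch_def)
  have fin: "finite A" "finite B" using sub grown_finite[OF g] finite_subset by auto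
  have "card A > 0" "card B > 0" using fin ne by (auto simp: card_gt_0_iff)
  thus "N \<ge> 2" by (simp add: N_def)
  have N: "N = real (card (A \<union> B))" using card_Un_disjoint[OF fin disj] by (simp add: N_def)
  have "(\<Sum>v\<in>A \<union> B. ?deg v) = (\<Sum>v\<in>A. ?deg v) + (\<Sum>v\<in>B. ?deg v)" by (rule sum.union_disjoint[OF fin disj])
  hence "(\<Sum>v\<in>A \<union> B. ?deg v) \<le> 2 * (card A + card B)" using pd by (simp add: pendant_def)
  hence "real (\<Sum>v\<in>A \<union> B. ?deg v) \<le> real (2 * (card A + card B))" by (rule of_nat_mono)
  also have "\<dots> = 2 * N" by (simp add: N_def)
  finally have deg: "real (\<Sum>v\<in>A \<union> B. ?deg v) \<le> 2 * N" .
  have "(\<Sum>v\<in>verts t. ?deg v) = 2 * (?n - 1)" using g unfolding grown_def by blast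
  hence "real (\<Sum>v\<in>verts t. ?deg v) \<le> real (2 * ?n)" by (intro of_nat_mono) simp
  hence degV: "real (\<Sum>v\<in>verts t. ?deg v) \<le> 2 * real ?n" by (simp only: of_nat_mult of_nat_numeral)
  let ?U = "weight f t (A \<union> B)" and ?V = "weight f t (verts t)"
  have p: "p = ?U / ?V" unfolding p_def using prob_attach[OF g] j sub by simp
  have V0: "?V > 0" using weight_total_pos[OF g] j by simp
  have U1: "lo * N \<le> ?U" unfolding N using weight_ge[OF g, of "A \<union> B"] sub by simp
  have U2: "?U \<le> hi * (2 * N)"
    by (rule order_trans[OF weight_le[OF g] mult_left_mono[OF deg]]) (use sub hi_pos in auto)
  have V1: "lo * real ?n \<le> ?V" using weight_ge[OF g, of "verts t"] g by (simp add: grown_def)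
  have V2: "?V \<le> hi * (2 * real ?n)"
    by (rule order_trans[OF weight_le[OF g] mult_left_mono[OF degV]]) (use hi_pos in auto)
  have N0: "N \<ge> 0" by (simp add: N_def)
  have U0: "0 \<le> ?U" using U1 N0 lo_pos by (meson order_trans mult_nonneg_nonneg less_imp_le)
  have "lo / (2 * hi) * N / real ?n = lo * N / (hi * (2 * real ?n))" by simp
  also have "\<dots> \<le> ?U / ?V" using U0 U1 V2 V0 by (intro frac_le)
  finally show "lo / (2 * hi) * N / real ?n \<le> p" using p by simp
  have "?U / ?V \<le> hi * (2 * N) / (lo * real ?n)" using U2 V1 N0 hi_pos lo_pos j by (intro frac_le) auto
  also have "\<dots> = 2 * hi / lo * N / real ?n" by simp
  finally show "p \<le> 2 * hi / lo * N / real ?n" using p by simp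
qed

text \<open>From a tie, any vertex that joins one of the branches destroys the potential \<open>1 / N\<close>. Without a
tie there is no potential, and it can appear, with a value of at most \<open>1 / N\<close>, only if the new vertex
joins a branch. The factor \<open>1 / N\<close> cancels the size of the branches in the probability of being hit,
so both rates depend on the time alone.\<close>

lemma potential_step:
  assumes j: "j \<ge> 3" and s: "(t, A, B) \<in> set_pmf (marked f j k)"
  defines "next v \<equiv> (add_leaf t v (Suc (j + k)), extend v (Suc (j + k)) A, extend v (Suc (j + k)) B)"
  shows "measure_pmf.expectation (attach_vertex f t) (\<lambda>v. potential j (next v)) \<le> potential j (t, A, B)
    - lo / (2 * hi) / real (j + k) * of_bool (tie j (t, A, B))
    + 2 * hi / lo / real (j + k) * of_bool (nontie j (t, A, B))"
proof (cases "root_leaf j t")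
  case False
  hence "potential j (next v) = 0" for v
    using root_leaf_add_later_leaf[of j "Suc (j + k)" t v] j by (simp add: next_def potential_def tie_def)
  thus ?thesis using False by (simp add: tie_def nontie_def potential_def)
next
  case True
  let ?M = "attach_vertex f t" and ?n = "Suc (j + k)"
  define N where "N = real (card A) + real (card B)"
  have g: "grown (j + k) t" using marked_grown[OF _ s] j by simp
  have pd: "pendant t A 1" "pendant t B j" and disj: "A \<inter> B = {}" using marked_pendant[OF j s True] by auto
  have sub: "A \<subseteq> verts t" "B \<subseteq> verts t" using pd by (auto simp: pendant_def branch_def)
  have fin: "finite A" "finite B" using sub grown_finite[OF g] finite_subset by auto
  have new: "?n \<notin> A" "?n \<notin> B" using sub g by (auto simp: grown_def)
  have cA: "card (extend v ?n A) = card A + of_bool (v \<in> A)"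
    and cB: "card (extend v ?n B) = card B + of_bool (v \<in> B)" for v
    using fin new by (auto simp: extend_def)
  have q: "root_leaf j (add_leaf t v ?n)" for v using root_leaf_add_later_leaf[of j ?n t v] j True by simp
  note hit = prob_hit_branches[OF j s True, folded N_def]
  have finM: "finite (set_pmf ?M)" using set_attach[OF g] grown_finite[OF g] j by simp
  define hits :: "nat \<Rightarrow> real" where "hits v = of_bool (v \<in> A \<union> B)" for v
  have hits: "measure_pmf.expectation ?M hits = measure_pmf.prob ?M (A \<union> B)"
    using prob_eq_expectation[of ?M "\<lambda>v. v \<in> A \<union> B"] unfolding hits_def[abs_def] by (simp only: Collect_mem_eq)
  have pot: "potential j (next v) =
      of_bool (card A + of_bool (v \<in> A) = card B + of_bool (v \<in> B)) / (N + of_bool (v \<in> A) + of_bool (v \<in> B))" for v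
    unfolding next_def potential_def tie_def N_def by (simp add: cA cB q)
  show ?thesis
  proof (cases "card A = card B")
    case eq: True
    have "potential j (next v) = (1 - hits v) / N" for v
      using disj eq unfolding pot hits_def by auto
    hence "measure_pmf.expectation ?M (\<lambda>v. potential j (next v)) = (1 - measure_pmf.prob ?M (A \<union> B)) / N"
      using finM by (simp add: integrable_measure_pmf_finite hits)
    also have "\<dots> \<le> (1 - lo / (2 * hi) * N / real (j + k)) / N"
      using hit by (intro divide_right_mono) auto
    also have "\<dots> = 1 / N - lo / (2 * hi) / real (j + k)" using hit(3) by (simp add: field_simps)
    finally show ?thesis using eq True by (simp add: potential_def tie_def nontie_def N_def)
  next
    case ne: False
    have "potential j (next v) \<le> hits v / N" for v
      using hit(3) ne unfolding pot hits_def by (auto simp: frac_le)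
    hence "measure_pmf.expectation ?M (\<lambda>v. potential j (next v)) \<le> measure_pmf.expectation ?M (\<lambda>v. hits v / N)"
      by (intro expectation_mono_finite finM)
    also have "\<dots> = measure_pmf.prob ?M (A \<union> B) / N" by (simp add: hits)
    also have "\<dots> \<le> (2 * hi / lo * N / real (j + k)) / N"
      using hit by (intro divide_right_mono) auto
    also have "\<dots> = 2 * hi / lo / real (j + k)" using hit(3) by simp
    finally show ?thesis using ne True by (simp add: potential_def tie_def nontie_def)
  qed
qed

definition untied :: "nat \<Rightarrow> nat \<Rightarrow> real" where
  "untied j k = measure_pmf.prob (marked f j k) {s. nontie j s}"

lemma prob_tie:
  assumes "j \<ge> 2"
  shows "measure_pmf.prob (marked f j k) {s. tie j s} = survival j - untied j k"
proof -
  have "survival j = measure_pmf.prob (map_pmf fst (marked f j k)) {t. root_leaf j t}"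
    using map_fst_marked[OF assms] prob_root_leaf_later[of j "j + k"] assms by simp
  also have "\<dots> = measure_pmf.prob (marked f j k) ({s. tie j s} \<union> {s. nontie j s})"
    unfolding measure_map_pmf by (rule arg_cong2[of _ _ _ _ measure]) (auto simp: tie_def nontie_def)
  also have "\<dots> = measure_pmf.prob (marked f j k) {s. tie j s} + untied j k"
    unfolding untied_def by (intro measure_pmf.finite_measure_Union) (auto simp: tie_def nontie_def)
  finally show ?thesis by simp
qed

abbreviation "flow_out \<equiv> lo / (2 * hi)"
abbreviation "flow_in \<equiv> 2 * hi / lo"

lemma potential_drift:
  assumes j: "j \<ge> 3"
  defines "\<phi> k \<equiv> measure_pmf.expectation (marked f j k) (potential j)"
  shows "\<phi> (Suc k) \<le> \<phi> k - (flow_out * survival j - (flow_out + flow_in) * untied j k) / real (j + k)"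
proof -
  let ?M = "marked f j k" and ?n = "real (j + k)"
  have fin: "finite (set_pmf ?M)" using finite_marked j by simp
  have int: "integrable (measure_pmf ?M) h" for h :: "marked_tree \<Rightarrow> real"
    using fin by (rule integrable_measure_pmf_finite)
  have "\<phi> (Suc k) = measure_pmf.expectation ?M (\<lambda>(t, A, B). measure_pmf.expectation (attach_vertex f t)
      (\<lambda>v. potential j (add_leaf t v (Suc (j + k)), extend v (Suc (j + k)) A, extend v (Suc (j + k)) B)))"
  proof -
    have "finite (set_pmf (attach_vertex f t))" if "(t, A, B) \<in> set_pmf ?M" for t A B
      using set_attach[OF marked_grown[OF _ that]] grown_finite[OF marked_grown[OF _ that]] j by simp
    thus ?thesis unfolding \<phi>_def marked.simps
      by (subst expectation_bind_pmf_finite[OF fin]) (auto simp: case_prod_unfold)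
  qed
  also have "\<dots> \<le> measure_pmf.expectation ?M (\<lambda>s. potential j s - flow_out / ?n * of_bool (tie j s) + flow_in / ?n * of_bool (nontie j s))"
  proof (rule expectation_mono_finite[OF fin], clarify)
    fix V E A B assume "((V, E), A, B) \<in> set_pmf ?M"
    from potential_step[OF j this] show "measure_pmf.expectation (attach_vertex f (V, E))
        (\<lambda>v. potential j (add_leaf (V, E) v (Suc (j + k)), extend v (Suc (j + k)) A, extend v (Suc (j + k)) B)) \<le>
      potential j ((V, E), A, B) - flow_out / ?n * of_bool (tie j ((V, E), A, B))
        + flow_in / ?n * of_bool (nontie j ((V, E), A, B))" .
  qed
  also have "\<dots> = \<phi> k - flow_out / ?n * (survival j - untied j k) + flow_in / ?n * untied j k"
    using prob_tie[of j k] j by (simp add: \<phi>_def int untied_def prob_eq_expectation)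
  also have "\<dots> = \<phi> k - (flow_out * survival j - (flow_out + flow_in) * untied j k) / ?n"
  proof -
    have "x - a / y * (s - u) + b / y * u = x - (a * s - (a + b) * u) / y" for a b s u x y :: real
      by (simp add: diff_divide_distrib add_divide_distrib algebra_simps)
    thus ?thesis .
  qed
  finally show ?thesis .
qed

text \<open>The potentials are added over \<open>j\<close> before the divergence argument is applied, so that one time \<open>n\<close>
serves all \<open>j\<close> together.\<close>

lemma untied_infinitely_often:
  assumes m: "m \<ge> 2"
  defines "J \<equiv> {m<..2 * m}"
  shows "\<exists>n \<ge> n1. n \<ge> 2 * m \<and>
    flow_out / (2 * (flow_out + flow_in)) * (\<Sum>j\<in>J. survival j) \<le> (\<Sum>j\<in>J. untied j (n - j))"
proof -
  define G where "G = (\<Sum>j\<in>J. survival j)"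
  define y where "y n = (\<Sum>j\<in>J. untied j (n - j))" for n
  define \<Phi> where "\<Phi> n = (\<Sum>j\<in>J. measure_pmf.expectation (marked f j (n - j)) (potential j))" for n
  have c: "flow_out > 0" "flow_in > 0" using lo_pos hi_pos by auto
  have G0: "G > 0" unfolding G_def J_def using m survival_pos by (intro sum_pos) auto
  have "\<Phi> n \<ge> 0" for n
    unfolding \<Phi>_def by (intro sum_nonneg Bochner_Integration.integral_nonneg potential_nonneg)
  moreover have "\<Phi> (Suc n) \<le> \<Phi> n - (flow_out * G - (flow_out + flow_in) * y n) / real n" if n: "n \<ge> 2 * m" for n
  proof -
    have "\<Phi> (Suc n) \<le> (\<Sum>j\<in>J. measure_pmf.expectation (marked f j (n - j)) (potential j)
        - (flow_out * survival j - (flow_out + flow_in) * untied j (n - j)) / real n)"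
      unfolding \<Phi>_def
    proof (rule sum_mono)
      fix j assume "j \<in> J"
      hence j: "j \<ge> 3" "j \<le> n" using m n by (auto simp: J_def)
      thus "measure_pmf.expectation (marked f j (Suc n - j)) (potential j) \<le>
          measure_pmf.expectation (marked f j (n - j)) (potential j)
          - (flow_out * survival j - (flow_out + flow_in) * untied j (n - j)) / real n"
        using potential_drift[OF j(1), of "n - j"] by (simp add: Suc_diff_le)
    qed
    also have "\<dots> = \<Phi> n - (flow_out * G - (flow_out + flow_in) * y n) / real n"
      by (simp add: \<Phi>_def G_def y_def sum_subtractf sum_divide_distrib[symmetric] sum_distrib_left)
    finally show ?thesis .
  qed
  moreover have "flow_out * G / 2 > 0" using mult_pos_pos[OF c(1) G0] by (rule half_gt_zero)
  ultimately have "\<exists>n \<ge> max n1 (2 * m). flow_out * G - (flow_out + flow_in) * y n \<le> flow_out * G / 2"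
    by (rule harmonic_drift)
  then obtain n where n: "n \<ge> max n1 (2 * m)" "flow_out * G - (flow_out + flow_in) * y n \<le> flow_out * G / 2"
    by blast
  have "flow_out * G / 2 \<le> (flow_out + flow_in) * y n" using n(2) by argo
  hence "(flow_out * G / 2) / (flow_out + flow_in) \<le> y n"
    using c by (subst pos_divide_le_eq) (auto simp: mult.commute)
  moreover have "(flow_out * G / 2) / (flow_out + flow_in) = flow_out / (2 * (flow_out + flow_in)) * G"
    using c by simp
  ultimately have "flow_out / (2 * (flow_out + flow_in)) * G \<le> y n" by metis
  thus ?thesis using n(1) unfolding G_def y_def by (intro exI[of _ n]) auto
qed

section \<open>The root has many more central competitors\<close>

lemma untied_le_twice:
  assumes j: "j \<ge> 3"
  shows "untied j k \<le> 2 * measure_pmf.prob (marked f j k) {(t, A, B). root_leaf j t \<and> card A < card B}"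
proof -
  let ?M = "marked f j k"
  let ?L = "{(t, A, B). root_leaf j t \<and> card A < card B}" and ?G = "{(t, A, B). root_leaf j t \<and> card B < card A}"
  have "untied j k = measure_pmf.prob ?M (?L \<union> ?G)"
    unfolding untied_def by (rule arg_cong2[of _ _ _ _ measure]) (auto simp: nontie_def)
  also have "\<dots> \<le> measure_pmf.prob ?M ?L + measure_pmf.prob ?M ?G"
    by (rule measure_Un_le) auto
  also have "measure_pmf.prob ?M ?G \<le> measure_pmf.prob ?M ?L"
    by (rule order_trans[OF rel_pmf_measureD[OF marked_symmetric[OF j]]])
       (auto intro!: measure_pmf.finite_measure_mono dest: mirror_card)
  finally show ?thesis by simp
qed

lemma prob_more_central:
  assumes j: "j \<ge> 3" "j \<le> n"
  shows "untied j (n - j) \<le> 2 * measure_pmf.prob (random_tree f n)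
    {t. root_leaf j t \<and> jordan_centrality t j < jordan_centrality t 1}"
proof -
  let ?M = "marked f j (n - j)"
  have "measure_pmf.prob ?M {(t, A, B). root_leaf j t \<and> card A < card B} \<le>
      measure_pmf.prob ?M (fst -` {t. root_leaf j t \<and> jordan_centrality t j < jordan_centrality t 1})"
  proof (rule measure_pmf.finite_measure_mono_AE)
    have "jordan_centrality t j < jordan_centrality t 1"
      if s: "(t, A, B) \<in> set_pmf ?M" and q: "root_leaf j t" and less: "card A < card B" for t A B
    proof (rule larger_branch_more_central)
      show "finite_tree t" using marked_grown[OF _ s] j by (simp add: grown_def)
      show "branch t A 1" "branch t B j" "A \<inter> B = {}"
        using marked_pendant[OF j(1) s q] by (auto simp: pendant_def)
    qed (rule less)
    thus "AE s in measure_pmf ?M. s \<in> {(t, A, B). root_leaf j t \<and> card A < card B} \<longrightarrow>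
        s \<in> fst -` {t. root_leaf j t \<and> jordan_centrality t j < jordan_centrality t 1}"
      by (auto intro!: AE_pmfI)
  qed simp
  also have "\<dots> = measure_pmf.prob (random_tree f n) {t. root_leaf j t \<and> jordan_centrality t j < jordan_centrality t 1}"
    using map_fst_marked[of j f "n - j"] j unfolding measure_map_pmf[symmetric] by simp
  finally show ?thesis using untied_le_twice[OF j(1), of "n - j"] by linarith
qed

text \<open>While the tree doubles its size, a root that is a leaf remains one with a probability bounded below.\<close>

lemma survival_halving: "\<exists>r > 0. \<exists>m0 \<ge> 2. \<forall>m \<ge> m0. \<forall>j \<in> {m<..2 * m}. r * survival m \<le> survival j"
proof -
  obtain B where B: "B \<ge> 1" "\<And>k m. B < real k \<Longrightarrow> k \<le> m \<Longrightarrow>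
      survival k * ((real k - B) / (real m - B)) powr (f 1 / lo) \<le> survival m"
  proof -
    have "lo * real n - 0 \<le> weight f t (verts t)" if "grown n t" for n t
      using weight_ge[OF that order_refl] that by (simp add: grown_def)
    thus ?thesis using survival_decay[OF lo_pos order_refl] that by blast
  qed
  \<comment> \<open>For \<open>m \<ge> 2 * B\<close> and \<open>j \<le> 2 * m\<close> the ratio \<open>(m - B) / (j - B)\<close> is at least \<open>1 / 4\<close>.\<close>
  define m0 where "m0 = nat \<lceil>2 * B\<rceil>"
  have m0: "real m0 \<ge> 2 * B" unfolding m0_def by linarith
  have "(1 / 4) powr (f 1 / lo) * survival m \<le> survival j" if m: "m \<ge> m0" and j: "j \<in> {m<..2 * m}" for m j
  proof -
    have mB: "real m \<ge> 2 * B" using m m0 by linarith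
    have jm: "m \<le> j" "real j \<le> 2 * real m" "real m < real j" using j by auto
    have "real j - B \<le> 4 * (real m - B)" "real j - B > 0" using mB B(1) jm by argo+
    hence "1 / 4 \<le> (real m - B) / (real j - B)" by (simp add: field_simps)
    hence "(1 / 4) powr (f 1 / lo) \<le> ((real m - B) / (real j - B)) powr (f 1 / lo)"
      using f_pos[of 1] lo_pos by (intro powr_mono2) auto
    moreover have "survival m \<ge> 0" by (simp add: survival_def)
    ultimately have "(1 / 4) powr (f 1 / lo) * survival m \<le> survival m * ((real m - B) / (real j - B)) powr (f 1 / lo)"
      by (subst mult.commute) (intro mult_left_mono)
    also have "\<dots> \<le> survival j" using mB B(1) jm by (intro B(2)) auto
    finally show ?thesis .
  qed
  moreover have "m0 \<ge> 2" using m0 B(1) by linarith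
  moreover have "(1 / 4 :: real) powr (f 1 / lo) > 0" by simp
  ultimately show ?thesis by blast
qed

text \<open>Let \<open>X\<close> be the number of \<open>j\<close> in \<open>{m<..2 * m}\<close> such that \<open>v\<^sub>j\<close> beats the root. The
expectation of \<open>X\<close> on the event that the root is a leaf at time \<open>m\<close> is at least
\<open>2 * \<theta> * m * survival m\<close>, whereas \<open>X \<le> m\<close>; hence \<open>X\<close> reaches \<open>\<theta> * m\<close> with probability at least
\<open>\<theta> * survival m\<close>.\<close>

lemma many_more_central:
  "\<exists>\<theta> > 0. \<exists>m0 \<ge> 2. \<forall>m \<ge> m0. \<forall>n1. \<exists>n \<ge> n1. n \<ge> 2 \<and> (\<forall>K. real K \<le> \<theta> * real m \<longrightarrow>
    \<theta> * survival m \<le> measure_pmf.prob (random_tree f n)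
      {t. K \<le> card {v \<in> verts t. jordan_centrality t v < jordan_centrality t 1}})"
proof -
  obtain r m0 where r: "r > 0" and m0: "m0 \<ge> 2"
    and surv: "\<And>m j. m \<ge> m0 \<Longrightarrow> j \<in> {m<..2 * m} \<Longrightarrow> r * survival m \<le> survival j"
    using survival_halving by metis
  define \<delta> where "\<delta> = flow_out / (2 * (flow_out + flow_in))"
  have \<delta>: "\<delta> > 0" unfolding \<delta>_def
    using lo_pos hi_pos by (intro divide_pos_pos mult_pos_pos add_pos_pos) auto
  \<comment> \<open>One factor 2 is lost by the symmetry, another one by the reverse Markov inequality.\<close>
  define \<theta> where "\<theta> = \<delta> * r / 4"
  have \<theta>: "\<theta> > 0" using \<delta> r by (simp add: \<theta>_def)
  have "\<exists>n \<ge> n1. n \<ge> 2 \<and> (\<forall>K. real K \<le> \<theta> * real m \<longrightarrow> \<theta> * survival m \<le> measure_pmf.prob (random_tree f n)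
      {t. K \<le> card {v \<in> verts t. jordan_centrality t v < jordan_centrality t 1}})" if m: "m \<ge> m0" for m n1
  proof -
    let ?J = "{m<..2 * m}"
    have m2: "m \<ge> 2" using m m0 by simp
    obtain n where n: "n \<ge> n1" "n \<ge> 2 * m" and y: "\<delta> * (\<Sum>j\<in>?J. survival j) \<le> (\<Sum>j\<in>?J. untied j (n - j))"
      using untied_infinitely_often[OF m2, of n1] unfolding \<delta>_def by blast
    let ?T = "random_tree f n"
    have fin: "finite (set_pmf ?T)" using finite_random_tree n m2 by simp
    have int: "integrable (measure_pmf ?T) h" for h :: "nat graph \<Rightarrow> real"
      using fin by (rule integrable_measure_pmf_finite)
    define beats where "beats j t \<longleftrightarrow> jordan_centrality t j < jordan_centrality t 1" for j and t :: "nat graph"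
    define X where "X t = real (card {j \<in> ?J. beats j t})" for t
    have X: "X t = (\<Sum>j\<in>?J. of_bool (beats j t))" for t by (simp add: X_def of_bool_def sum.If_cases Int_def)
    have "2 * \<theta> * real m * survival m = \<delta> * (\<Sum>j\<in>?J. r * survival m) / 2"
      by (simp add: \<theta>_def)
    also have "\<dots> \<le> \<delta> * (\<Sum>j\<in>?J. survival j) / 2"
      using surv[OF m] \<delta> by (intro divide_right_mono mult_left_mono sum_mono) auto
    also have "\<dots> \<le> (\<Sum>j\<in>?J. untied j (n - j)) / 2" using y by simp
    also have "\<dots> \<le> (\<Sum>j\<in>?J. measure_pmf.prob ?T {t. root_leaf j t \<and> beats j t})"
    proof -
      have "untied j (n - j) \<le> 2 * measure_pmf.prob ?T {t. root_leaf j t \<and> beats j t}" if "j \<in> ?J" for j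
        unfolding beats_def using prob_more_central[of j n] that m2 n by simp
      hence "(\<Sum>j\<in>?J. untied j (n - j)) \<le> (\<Sum>j\<in>?J. 2 * measure_pmf.prob ?T {t. root_leaf j t \<and> beats j t})"
        by (rule sum_mono)
      thus ?thesis by (simp add: sum_distrib_left[symmetric])
    qed
    also have "\<dots> \<le> (\<Sum>j\<in>?J. measure_pmf.expectation ?T (\<lambda>t. of_bool (root_leaf m t) * of_bool (beats j t)))"
      unfolding prob_eq_expectation
      by (intro sum_mono expectation_mono_finite[OF fin]) (auto intro: root_leaf_antimono)
    also have "\<dots> = measure_pmf.expectation ?T (\<lambda>t. of_bool (root_leaf m t) * X t)"
      unfolding X sum_distrib_left by (rule Bochner_Integration.integral_sum[symmetric]) (rule int)
    finally have EX: "2 * \<theta> * real m * survival m \<le> measure_pmf.expectation ?T (\<lambda>t. of_bool (root_leaf m t) * X t)" .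
    have "\<theta> * survival m \<le> measure_pmf.prob ?T
        {t. K \<le> card {v \<in> verts t. jordan_centrality t v < jordan_centrality t 1}}" (is "_ \<le> measure_pmf.prob _ ?E")
      if K: "real K \<le> \<theta> * real m" for K
    proof -
      have "of_bool (root_leaf m t) * X t \<le> real m * of_bool (t \<in> ?E) + real K * of_bool (root_leaf m t)"
        if t: "t \<in> set_pmf ?T" for t
      proof -
        have V: "verts t = {1..n}" using random_tree_grown[of n t] t n m2 by (simp add: grown_def)
        have "X t \<le> real (card {v \<in> verts t. beats v t})"
          unfolding X_def V using n by (intro of_nat_mono card_mono) auto
        moreover have "card {j \<in> ?J. beats j t} \<le> card ?J" by (intro card_mono) auto
        hence "X t \<le> real m" by (simp add: X_def)
        ultimately show ?thesis by (auto simp: beats_def)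
      qed
      hence "measure_pmf.expectation ?T (\<lambda>t. of_bool (root_leaf m t) * X t) \<le>
          measure_pmf.expectation ?T (\<lambda>t. real m * of_bool (t \<in> ?E) + real K * of_bool (root_leaf m t))"
        by (rule expectation_mono_finite[OF fin])
      also have "\<dots> = real m * measure_pmf.prob ?T ?E + real K * survival m"
        using prob_root_leaf_later[of m n] m2 n prob_eq_expectation[of ?T "\<lambda>t. t \<in> ?E"]
        by (simp add: int prob_eq_expectation)
      also have "\<dots> \<le> real m * measure_pmf.prob ?T ?E + \<theta> * real m * survival m"
        using K by (intro add_left_mono mult_right_mono) (auto simp: survival_def)
      finally have "2 * \<theta> * real m * survival m \<le> real m * measure_pmf.prob ?T ?E + \<theta> * real m * survival m"
        by (rule order_trans[OF EX])
      hence "real m * (\<theta> * survival m) \<le> real m * measure_pmf.prob ?T ?E" by (simp add: algebra_simps)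
      thus ?thesis using m2 by simp
    qed
    thus ?thesis using n m2 by (intro exI[of _ n]) auto
  qed
  thus ?thesis using \<theta> m0 by blast
qed

section \<open>From the budget to the error\<close>

lemma prob_root_found_le:
  assumes alg: "jordan_algorithm H" and K: "K \<ge> 1" and n: "n \<ge> 2"
  shows "measure_pmf.prob (root_found f (H K) n) {True} \<le> 1 - measure_pmf.prob (random_tree f n)
    {t. K \<le> card {v \<in> verts t. jordan_centrality t v < jordan_centrality t 1}}" (is "_ \<le> 1 - measure_pmf.prob ?T ?E")
proof -
  define run where "run t = map_pmf (\<lambda>\<phi>. \<phi> 1 \<in> H K (representative (iso_class t)))
    (pmf_of_set (graph_isos t (representative (iso_class t))))" for t
  have fin: "finite (set_pmf ?T)" using finite_random_tree n .
  have "measure_pmf.prob (root_found f (H K) n) {True} = measure_pmf.expectation (bind_pmf ?T run) of_bool"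
    unfolding prob_True_eq_expectation by (simp add: root_found_def run_def[abs_def] Let_def)
  also have "\<dots> = measure_pmf.expectation ?T (\<lambda>t. measure_pmf.expectation (run t) of_bool)"
    by (rule expectation_bind_pmf_finite[OF fin]) simp
  also have "\<dots> \<le> measure_pmf.expectation ?T (\<lambda>t. 1 - of_bool (t \<in> ?E))"
  proof (rule expectation_mono_finite[OF fin])
    fix t assume "t \<in> set_pmf ?T"
    hence g: "grown n t" using random_tree_grown n by blast
    hence tree: "finite_tree t" and V: "verts t = {1..n}" by (auto simp: grown_def)
    let ?r = "representative (iso_class t)"
    have ne: "graph_isos t ?r \<noteq> {}" using tree by (intro representative_iso) (simp add: finite_tree_def)
    then obtain \<phi> where "\<phi> \<in> graph_isos t ?r" by blast
    hence "finite (verts ?r)" using finite_tree_iso[OF _ tree] by (auto simp: finite_tree_def)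
    hence fin_iso: "finite (graph_isos t ?r)" using finite_graph_isos[of t ?r] V by simp
    have "measure_pmf.expectation (run t) of_bool = measure_pmf.prob (run t) {True}"
      by (simp only: prob_True_eq_expectation)
    also have "\<dots> \<le> 1 - of_bool (t \<in> ?E)"
    proof (cases "t \<in> ?E")
      case True
      have "\<phi> 1 \<notin> H K ?r" if "\<phi> \<in> graph_isos t ?r" for \<phi>
      proof (rule jordan_algorithm_misses[OF alg K tree _ that])
        show "2 \<le> card (verts t)" "1 \<in> verts t" using V n by simp_all
        show "{v \<in> verts t. jordan_centrality t v < jordan_centrality t 1} \<subseteq> verts t" by blast
        show "K \<le> card {v \<in> verts t. jordan_centrality t v < jordan_centrality t 1}" using True by blast
      qed blast
      hence "True \<notin> set_pmf (run t)" unfolding run_def using ne fin_iso by auto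
      thus ?thesis using True by (simp add: measure_pmf_single set_pmf_iff)
    qed simp
    finally show "measure_pmf.expectation (run t) of_bool \<le> (1 - of_bool (t \<in> ?E) :: real)" .
  qed
  also have "\<dots> = 1 - measure_pmf.prob ?T ?E"
    using prob_eq_expectation[of ?T "\<lambda>t. t \<in> ?E"] fin by (simp add: integrable_measure_pmf_finite)
  finally show ?thesis .
qed

lemma root_finding_error_ge:
  "\<exists>\<theta> > 0. \<exists>m0 \<ge> 2. \<forall>H K m \<epsilon>. jordan_algorithm H \<longrightarrow> K \<ge> 1 \<longrightarrow> root_finding f (H K) \<epsilon> \<longrightarrow>
     m \<ge> m0 \<longrightarrow> real K \<le> \<theta> * real m \<longrightarrow> \<theta> * survival m \<le> \<epsilon>"
proof -
  obtain \<theta> m0 where \<theta>: "\<theta> > 0" and m0: "m0 \<ge> 2"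
    and many: "\<forall>m \<ge> m0. \<forall>n1. \<exists>n \<ge> n1. n \<ge> 2 \<and> (\<forall>K. real K \<le> \<theta> * real m \<longrightarrow>
      \<theta> * survival m \<le> measure_pmf.prob (random_tree f n)
        {t. K \<le> card {v \<in> verts t. jordan_centrality t v < jordan_centrality t 1}})"
    using many_more_central by blast
  have "\<theta> * survival m \<le> \<epsilon>" if alg: "jordan_algorithm H" and K: "K \<ge> 1" and rf: "root_finding f (H K) \<epsilon>"
    and m: "m \<ge> m0" and Km: "real K \<le> \<theta> * real m" for H K m \<epsilon>
  proof (rule ccontr)
    assume "\<not> \<theta> * survival m \<le> \<epsilon>"
    hence "ereal (1 - \<theta> * survival m) < ereal (1 - \<epsilon>)" by simp
    also have "\<dots> \<le> liminf (\<lambda>n. ereal (measure_pmf.prob (root_found f (H K) n) {True}))"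
      using rf by (simp only: root_finding_def)
    finally have "\<forall>\<^sub>F n in sequentially. 1 - \<theta> * survival m < measure_pmf.prob (root_found f (H K) n) {True}"
      using less_LiminfD by fastforce
    then obtain n1 where n1: "\<And>n. n \<ge> n1 \<Longrightarrow> 1 - \<theta> * survival m < measure_pmf.prob (root_found f (H K) n) {True}"
      unfolding eventually_sequentially by blast
    obtain n where n: "n \<ge> n1" "n \<ge> 2" and nK: "\<forall>K. real K \<le> \<theta> * real m \<longrightarrow>
        \<theta> * survival m \<le> measure_pmf.prob (random_tree f n)
          {t. K \<le> card {v \<in> verts t. jordan_centrality t v < jordan_centrality t 1}}"
      using many[rule_format, OF m, of n1] by blast
    show False
      using prob_root_found_le[OF alg K n(2)] n1[OF n(1)] nK[rule_format, OF Km] by linarith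
  qed
  thus ?thesis using \<theta> m0 by blast
qed

text \<open>Choose \<open>m\<close> of order \<open>K / \<theta>\<close> in the lower bound \<open>\<theta> * survival m\<close> for the error and solve for \<open>K\<close>.\<close>

lemma min_budget_lower_bound:
  assumes g: "g > 0" and h: "h \<ge> 0"
    and W: "\<And>n t. grown n t \<Longrightarrow> n \<ge> 2 \<Longrightarrow> g * real n - h \<le> weight f t (verts t)"
  shows "\<exists>C > 0. \<forall>H. jordan_algorithm H \<longrightarrow> (\<forall>\<epsilon>. 0 < \<epsilon> \<and> \<epsilon> < 1 \<longrightarrow>
    ereal_of_enat (min_budget f H \<epsilon>) \<ge> ereal (C / \<epsilon> powr (g / f 1)))"
proof -
  define \<gamma> where "\<gamma> = f 1 / g"
  have \<gamma>: "\<gamma> > 0" "1 / \<gamma> = g / f 1" using f_pos[of 1] g by (auto simp: \<gamma>_def)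
  obtain B where B: "B \<ge> 1" "\<And>k m. B < real k \<Longrightarrow> k \<le> m \<Longrightarrow>
      survival k * ((real k - B) / (real m - B)) powr \<gamma> \<le> survival m"
    using survival_decay[OF g h W] unfolding \<gamma>_def by metis
  obtain \<theta> m0 where \<theta>: "\<theta> > 0" and m0: "m0 \<ge> 2"
    and err: "\<forall>H K m \<epsilon>. jordan_algorithm H \<longrightarrow> K \<ge> 1 \<longrightarrow> root_finding f (H K) \<epsilon> \<longrightarrow>
     m \<ge> m0 \<longrightarrow> real K \<le> \<theta> * real m \<longrightarrow> \<theta> * survival m \<le> \<epsilon>"
    using root_finding_error_ge by blast
  define k where "k = m0 + nat \<lceil>B\<rceil> + 1"
  have k: "B < real k" "k \<ge> m0" unfolding k_def by linarith+
  define D where "D = survival k * (real k - B) powr \<gamma>"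
  have D: "D > 0" unfolding D_def using survival_pos[of k] k m0 by simp
  have surv: "D * real m powr (- \<gamma>) \<le> survival m" if m: "m \<ge> k" for m
  proof -
    have "D * real m powr (- \<gamma>) \<le> D * (real m - B) powr (- \<gamma>)"
      using D m k B(1) \<gamma> by (intro mult_left_mono powr_mono2') auto
    also have "\<dots> = survival k * ((real k - B) / (real m - B)) powr \<gamma>"
      using m k by (simp add: D_def powr_divide powr_minus divide_simps)
    also have "\<dots> \<le> survival m" using B(2)[OF k(1) m] .
    finally show ?thesis .
  qed
  define M where "M = real k + 1 / \<theta> + 1"
  have M: "M > 0" using \<theta> by (simp add: M_def add_nonneg_pos)
  define C where "C = (\<theta> * D) powr (1 / \<gamma>) / M"
  have C: "C > 0" using \<theta> D M by (simp add: C_def)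
  have K_ge: "C / \<epsilon> powr (g / f 1) \<le> real K"
    if alg: "jordan_algorithm H" and \<epsilon>: "\<epsilon> > 0" and K: "K \<ge> 1" and rf: "root_finding f (H K) \<epsilon>" for H \<epsilon> K
  proof -
    \<comment> \<open>As \<open>K \<ge> 1\<close>, this \<open>m\<close> is at most \<open>M * K\<close>.\<close>
    define m where "m = k + nat \<lceil>real K / \<theta>\<rceil>"
    have m: "m \<ge> k" "real K / \<theta> \<le> real m" unfolding m_def by linarith+
    hence "real K \<le> \<theta> * real m" using \<theta> by (simp add: field_simps)
    hence e: "\<theta> * survival m \<le> \<epsilon>" using err alg K rf m k by simp
    have "real m \<le> real k + real K / \<theta> + 1" unfolding m_def using \<theta> by (simp add: ceiling_le_iff)
    also have "\<dots> \<le> M * real K"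
      using K mult_left_mono[of 1 "real K" "real k + 1"] by (simp add: M_def algebra_simps)
    finally have mM: "real m \<le> M * real K" .
    have m_pos: "real m > 0" using m k m0 by simp
    have "\<theta> * (D * real m powr (- \<gamma>)) \<le> \<theta> * survival m"
      using surv[OF m(1)] \<theta> by (intro mult_left_mono) auto
    hence "\<theta> * D * real m powr (- \<gamma>) \<le> \<epsilon>" using e by (simp add: mult.assoc)
    hence "\<theta> * D / \<epsilon> \<le> real m powr \<gamma>" using \<epsilon> m_pos by (simp add: powr_minus field_simps)
    hence "(\<theta> * D / \<epsilon>) powr (1 / \<gamma>) \<le> (real m powr \<gamma>) powr (1 / \<gamma>)"
      using \<theta> D \<epsilon> \<gamma>(1) by (intro powr_mono2) auto
    also have "\<dots> = real m" using \<gamma>(1) m_pos by (simp add: powr_powr)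
    also have "\<dots> \<le> M * real K" by (rule mM)
    finally have "(\<theta> * D) powr (1 / \<gamma>) / \<epsilon> powr (1 / \<gamma>) \<le> M * real K"
      using \<theta> D \<epsilon> by (simp add: powr_divide)
    hence "(\<theta> * D) powr (1 / \<gamma>) / \<epsilon> powr (1 / \<gamma>) / M \<le> real K"
      using M by (simp only: pos_divide_le_eq mult.commute)
    thus ?thesis unfolding C_def \<gamma>(2)[symmetric] by (simp add: mult.commute)
  qed
  have "ereal (C / \<epsilon> powr (g / f 1)) \<le> ereal_of_enat (min_budget f H \<epsilon>)"
    if alg: "jordan_algorithm H" and \<epsilon>: "\<epsilon> > 0" for H \<epsilon>
  proof (cases "{K. K \<ge> 1 \<and> root_finding f (H K) \<epsilon>} = {}")
    case True
    thus ?thesis unfolding min_budget_def by (simp only: image_empty) (simp add: top_enat_def)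
  next
    case False
    hence "min_budget f H \<epsilon> \<in> enat ` {K. K \<ge> 1 \<and> root_finding f (H K) \<epsilon>}"
      unfolding min_budget_def by (auto simp: Inf_enat_def intro: LeastI)
    then obtain K where "K \<ge> 1" "root_finding f (H K) \<epsilon>" "min_budget f H \<epsilon> = enat K" by blast
    thus ?thesis using K_ge[OF alg \<epsilon>] by simp
  qed
  thus ?thesis using C by blast
qed

end

theorem theorem3p2:
  fixes f :: "nat \<Rightarrow> real"
  assumes pos: "\<And>i. i \<ge> 1 \<Longrightarrow> f i > 0"
    and inf_pos: "(INF i\<in>{1..}. f i) > 0"
    and linear: "\<exists>C. \<forall>k\<ge>1. f k \<le> C * real k"
    and lambda_low_finite: "lambda_low f < \<infinity>"
    and rho_limit: "\<exists>L > 1. (rho_hat f \<longlongrightarrow> L) (at_right (real_of_ereal (lambda_low f)))"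
    and limsup: "limsup (\<lambda>i. ereal (f i / real i)) < ereal (lambda_star f)"
  shows
    "(\<forall>C\<^sub>f \<beta>. C\<^sub>f > 0 \<and> \<beta> \<ge> 0 \<and> (\<forall>i\<ge>1. f i \<ge> C\<^sub>f * real i + \<beta>) \<longrightarrow>
       (\<exists>C\<^sub>1 > 0. \<forall>H. jordan_algorithm H \<longrightarrow> (\<forall>\<epsilon>. 0 < \<epsilon> \<and> \<epsilon> < 1 \<longrightarrow>
          ereal_of_enat (min_budget f H \<epsilon>) \<ge> ereal (C\<^sub>1 / \<epsilon> powr ((2 * C\<^sub>f + \<beta>) / f 1))))) \<and>
     (\<exists>C\<^sub>1 > 0. \<forall>H. jordan_algorithm H \<longrightarrow> (\<forall>\<epsilon>. 0 < \<epsilon> \<and> \<epsilon> < 1 \<longrightarrow>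
        ereal_of_enat (min_budget f H \<epsilon>) \<ge> ereal (C\<^sub>1 / \<epsilon> powr ((INF i\<in>{1..}. f i) / f 1))))"
proof -
  obtain C where C: "\<And>k. k \<ge> 1 \<Longrightarrow> f k \<le> C * real k" using linear by blast
  define lo where "lo = (INF i\<in>{1..}. f i)"
  have bdd: "bdd_below (f ` {1..})" using pos by (intro bdd_belowI[of _ 0]) (auto intro: less_imp_le)
  have lo: "lo \<le> f i" if "i \<ge> 1" for i unfolding lo_def using bdd that by (intro cINF_lower) auto
  interpret attachment f lo C using inf_pos lo C by unfold_locales (auto simp: lo_def)
  show ?thesis
  proof (intro conjI allI impI)
    fix c \<beta> :: real assume c: "c > 0 \<and> \<beta> \<ge> 0 \<and> (\<forall>i\<ge>1. f i \<ge> c * real i + \<beta>)"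
    \<comment> \<open>The degrees sum to \<open>2 * (n - 1)\<close>.\<close>
    have "(2 * c + \<beta>) * real n - 2 * c \<le> weight f t (verts t)" if g: "grown n t" and n: "n \<ge> 2" for n t
    proof -
      have "(\<Sum>v\<in>verts t. c * real (vertex_degree t v) + \<beta>) \<le> weight f t (verts t)"
        unfolding weight_def using g c by (intro sum_mono) (auto simp: grown_def)
      also have "(\<Sum>v\<in>verts t. c * real (vertex_degree t v) + \<beta>) =
          c * real (\<Sum>v\<in>verts t. vertex_degree t v) + \<beta> * real (card (verts t))"
        by (simp add: sum.distrib sum_distrib_left)
      also have "(\<Sum>v\<in>verts t. vertex_degree t v) = 2 * (n - 1)" using g unfolding grown_def by blast
      also have "card (verts t) = n" using g by (simp add: grown_def)
      finally show ?thesis using n by (simp add: algebra_simps of_nat_diff)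
    qed
    thus "\<exists>C\<^sub>1>0. \<forall>H. jordan_algorithm H \<longrightarrow> (\<forall>\<epsilon>. 0 < \<epsilon> \<and> \<epsilon> < 1 \<longrightarrow>
        ereal (C\<^sub>1 / \<epsilon> powr ((2 * c + \<beta>) / f 1)) \<le> ereal_of_enat (min_budget f H \<epsilon>))"
      using c by (intro min_budget_lower_bound[where h = "2 * c"]) auto
  next
    have "lo * real n - 0 \<le> weight f t (verts t)" if "grown n t" for n t
      using weight_ge[OF that order_refl] that by (simp add: grown_def)
    thus "\<exists>C\<^sub>1>0. \<forall>H. jordan_algorithm H \<longrightarrow> (\<forall>\<epsilon>. 0 < \<epsilon> \<and> \<epsilon> < 1 \<longrightarrow>
        ereal (C\<^sub>1 / \<epsilon> powr ((INF i\<in>{1..}. f i) / f 1)) \<le> ereal_of_enat (min_budget f H \<epsilon>))"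
      unfolding lo_def[symmetric] by (intro min_budget_lower_bound[OF lo_pos order_refl])
  qed
qed

end
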